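(* Let $k$ be a field and let $I$ be a monomial ideal of $R=k[x_1,\ldots,x_n]$ whose polarization $\mathcal{P}(I)$ is the facet ideal of a simplicial tree. Then $I$ is sequentially Cohen-Macaulay.
   Context: Polarization: for a monomial $M=x_1^{a_1}\cdots x_n^{a_n}$ put $\mathcal{P}(M)=\prod_{i=1}^n\prod_{j=1}^{a_i}x_{i,j}$, a square-free monomial in a polynomial ring $S=k[x_{i,j}]$ with sufficiently many variables. For a monomial ideal $I=(M_1,\ldots,M_q)$, $\mathcal{P}(I)=(\mathcal{P}(M_1),\ldots,\mathcal{P}(M_q))\subseteq S$. Sequentially Cohen-Macaulay: a finitely generated $\mathbb{Z}$-graded module $M$ over a finitely generated $\mathbb{N}$-graded $k$-algebra (with degree-$0$ part $k$) is sequentially Cohen-Macaulay if there is a finite filtration $0=M_0\subset M_1\subset\cdots\subset M_r=M$ by graded submodules such that each quotient $M_i/M_{i-1}$ is Cohen-Macaulay and $\dim(M_1/M_0)<\dim(M_2/M_1)<\cdots<\dim(M_r/M_{r-1})$ (Krull dimensions). An ideal $I$ of $R$ is called sequentially Cohen-Macaulay if $R/I$ is. Facet ideals: a simplicial complex $\Delta$ is a collection of subsets (faces) of a finite vertex set, closed under taking subsets and containing all singletons of vertices; facets are its maximal faces. Vertices are identified with variables of a polynomial ring, and the facet ideal $\mathcal{F}(\Delta)$ is the ideal generated by the square-free monomials $\prod_{v\in F}v$, $F$ a facet of $\Delta$. A subcollection of $\Delta$ is a simplicial complex whose facet set is a subset of the facet set of $\Delta$. Trees: a facet $F$ of $\Delta$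 is a leaf if either $F$ is the only facet of $\Delta$, or there is a facet $G\neq F$ of $\Delta$ such that $F\cap H\subseteq G$ for every facet $H\ne F$ of $\Delta$. $\Delta$ is connected if any two facets can be joined by a sequence of facets in which consecutive ones intersect. $\Delta$ is a tree if it is connected and every nonempty subcollection of $\Delta$ has a leaf. *)

theory Defs
  imports
    "HOL-Algebra.Algebra"
    "HOL-Algebra.Algebraic_Closure_Type"
    "HOL-Library.Poly_Mapping"
    "HOL-Library.Extended_Nat"
begin

section \<open>Krull dimension and depth\<close>

text \<open>The supremum of the lengths of chains of prime ideals; it is 0 for the zero ring.\<close>

definition krull_dim :: "('a, 'c) ring_scheme \<Rightarrow> enat" where
  "krull_dim R =
     (SUP n \<in> {n. \<exists>P :: nat \<Rightarrow> 'a set. (\<forall>i\<le>n. primeideal (P i) R) \<and> (\<forall>i<n. P i \<subset> P (Suc i))}. enat n)"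

definition annihilator :: "('a, 'c) ring_scheme \<Rightarrow> ('a, 'b) module \<Rightarrow> 'a set" where
  "annihilator R M = {r \<in> carrier R. \<forall>x \<in> carrier M. r \<odot>\<^bsub>M\<^esub> x = \<zero>\<^bsub>M\<^esub>}"

definition module_dim :: "('a, 'c) ring_scheme \<Rightarrow> ('a, 'b) module \<Rightarrow> enat" where
  "module_dim R M = krull_dim (R Quot (annihilator R M))"

text \<open>The submodule \<open>(A)M\<close>.\<close>

definition ideal_smult :: "('a, 'c) ring_scheme \<Rightarrow> ('a, 'b) module \<Rightarrow> 'a set \<Rightarrow> 'b set" where
  "ideal_smult R M A =
     \<Inter>{N. submodule N R M \<and> (\<forall>a \<in> A. \<forall>x \<in> carrier M. a \<odot>\<^bsub>M\<^esub> x \<in> N)}"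

text \<open>
  The second conjunct says that \<open>rs ! i\<close> is a nonzerodivisor on
  \<open>M / (rs ! 0, \<dots>, rs ! (i - 1))M\<close>, the third that \<open>M / (rs)M\<close> is nonzero.
\<close>

definition regular_sequence :: "('a, 'c) ring_scheme \<Rightarrow> ('a, 'b) module \<Rightarrow> 'a list \<Rightarrow> bool" where
  "regular_sequence R M rs \<longleftrightarrow>
     set rs \<subseteq> carrier R \<and>
     (\<forall>i < length rs. \<forall>x \<in> carrier M.
        rs ! i \<odot>\<^bsub>M\<^esub> x \<in> ideal_smult R M (set (take i rs)) \<longrightarrow> x \<in> ideal_smult R M (set (take i rs))) \<and>
     ideal_smult R M (set rs) \<noteq> carrier M"

definition depth :: "('a, 'c) ring_scheme \<Rightarrow> 'a set \<Rightarrow> ('a, 'b) module \<Rightarrow> enat" where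
  "depth R J M = (SUP rs \<in> {rs. regular_sequence R M rs \<and> set rs \<subseteq> J}. enat (length rs))"


section \<open>Sequentially Cohen--Macaulay modules\<close>

text \<open>
  \<open>Rd\<close> is an \<open>\<nat>\<close>-grading of the ring \<open>R\<close> with \<open>Rd 0\<close> a field, and \<open>Md\<close> a \<open>\<int>\<close>-grading of the
  module \<open>M\<close>.  Cohen--Macaulayness of a finitely generated graded module is equality of the Krull
  dimension with the depth with respect to the irrelevant ideal.
\<close>

definition irrelevant_ideal :: "('a, 'c) ring_scheme \<Rightarrow> (nat \<Rightarrow> 'a set) \<Rightarrow> 'a set" where
  "irrelevant_ideal R Rd = Idl\<^bsub>R\<^esub> (\<Union>d \<in> {0<..}. Rd d)"

definition cohen_macaulay ::
    "('a, 'c) ring_scheme \<Rightarrow> (nat \<Rightarrow> 'a set) \<Rightarrow> ('a, 'b) module \<Rightarrow> bool" where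
  "cohen_macaulay R Rd M \<longleftrightarrow>
     carrier M \<noteq> {\<zero>\<^bsub>M\<^esub>} \<and> depth R (irrelevant_ideal R Rd) M = module_dim R M"

definition graded_submodule ::
    "('a, 'c) ring_scheme \<Rightarrow> ('a, 'b) module \<Rightarrow> (int \<Rightarrow> 'b set) \<Rightarrow> 'b set \<Rightarrow> bool" where
  "graded_submodule R M Md N \<longleftrightarrow>
     submodule N R M \<and>
     (\<forall>x \<in> N. \<exists>D f. finite D \<and> (\<forall>d \<in> D. f d \<in> N \<inter> Md d) \<and> x = (\<Oplus>\<^bsub>M\<^esub> d \<in> D. f d))"

text \<open>
  The quotient \<open>M / N\<close>.  As in \<^const>\<open>FactRing\<close>, the union in the scalar multiplication is a single
  coset.  The fields \<open>mult\<close> and \<open>one\<close> of the record are irrelevant for modules.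
\<close>

definition quot_module :: "('a, 'b) module \<Rightarrow> 'b set \<Rightarrow> ('a, 'b set) module" where
  "quot_module M N =
     \<lparr>carrier = a_rcosets\<^bsub>M\<^esub> N, monoid.mult = rcoset_mult M N, one = N +>\<^bsub>M\<^esub> \<one>\<^bsub>M\<^esub>,
      ring.zero = N, add = set_add M, module.smult = (\<lambda>r C. \<Union>x \<in> C. N +>\<^bsub>M\<^esub> (r \<odot>\<^bsub>M\<^esub> x))\<rparr>"

abbreviation subquotient :: "('a, 'b) module \<Rightarrow> 'b set \<Rightarrow> 'b set \<Rightarrow> ('a, 'b set) module" where
  "subquotient M N' N \<equiv> quot_module (M\<lparr>carrier := N'\<rparr>) N"

definition sequentially_cohen_macaulay ::
    "('a, 'c) ring_scheme \<Rightarrow> (nat \<Rightarrow> 'a set) \<Rightarrow> ('a, 'b) module \<Rightarrow> (int \<Rightarrow> 'b set) \<Rightarrow> bool" where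
  "sequentially_cohen_macaulay R Rd M Md \<longleftrightarrow>
     (\<exists>(r :: nat) F.
        F 0 = {\<zero>\<^bsub>M\<^esub>} \<and> F r = carrier M \<and>
        (\<forall>i\<le>r. graded_submodule R M Md (F i)) \<and>
        (\<forall>i<r. F i \<subset> F (Suc i)) \<and>
        (\<forall>i<r. cohen_macaulay R Rd (subquotient M (F (Suc i)) (F i))) \<and>
        (\<forall>i. Suc i < r \<longrightarrow>
           module_dim R (subquotient M (F (Suc i)) (F i))
             < module_dim R (subquotient M (F (Suc (Suc i))) (F (Suc i)))))"

definition self_module :: "('a, 'c) ring_scheme \<Rightarrow> ('a, 'a) module" where
  "self_module R =
     \<lparr>carrier = carrier R, monoid.mult = monoid.mult R, one = \<one>\<^bsub>R\<^esub>, ring.zero = \<zero>\<^bsub>R\<^esub>, add = add R, module.smult = monoid.mult R\<rparr>"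

text \<open>\<open>R / I\<close> carries the induced grading; the zero element of \<open>R / I\<close> is the coset \<open>I\<close>.\<close>

definition sequentially_cohen_macaulay_ideal ::
    "('a, 'c) ring_scheme \<Rightarrow> (nat \<Rightarrow> 'a set) \<Rightarrow> 'a set \<Rightarrow> bool" where
  "sequentially_cohen_macaulay_ideal R Rd I \<longleftrightarrow>
     sequentially_cohen_macaulay R Rd (quot_module (self_module R) I)
       (\<lambda>d. if d < 0 then {I} else (\<lambda>x. I +>\<^bsub>R\<^esub> x) ` Rd (nat d))"


section \<open>Monomial ideals and polarization\<close>

text \<open>
  A monomial in variables from \<open>'x\<close> is its exponent vector \<open>'x \<Rightarrow>\<^sub>0 nat\<close>, and a polynomial over
  \<open>'k\<close> a finitely supported function on monomials.
\<close>

type_synonym ('x, 'k) mpoly = "('x \<Rightarrow>\<^sub>0 nat) \<Rightarrow>\<^sub>0 'k"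

abbreviation mpoly_ring :: "('x, 'k::comm_ring_1) mpoly ring" where
  "mpoly_ring \<equiv> ring_of_type_algebra"

definition mpoly_homogeneous :: "nat \<Rightarrow> ('x, 'k::comm_ring_1) mpoly set" where
  "mpoly_homogeneous d =
     {p. \<forall>m \<in> Poly_Mapping.keys p. (\<Sum>x \<in> Poly_Mapping.keys m. Poly_Mapping.lookup m x) = d}"

definition monomial_ideal :: "('x \<Rightarrow>\<^sub>0 nat) set \<Rightarrow> ('x, 'k::comm_ring_1) mpoly set" where
  "monomial_ideal Ms = Idl\<^bsub>mpoly_ring\<^esub> ((\<lambda>m. Poly_Mapping.single m 1) ` Ms)"

text \<open>The variable \<open>(x, j)\<close> is \<open>x\<^sub>j\<close>, so that \<open>x\<^sup>a\<close> becomes \<open>x\<^sub>1 \<dots> x\<^sub>a\<close>.\<close>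

definition polarize :: "('x \<Rightarrow>\<^sub>0 nat) \<Rightarrow> ('x \<times> nat \<Rightarrow>\<^sub>0 nat)" where
  "polarize m =
     (\<Sum>x \<in> Poly_Mapping.keys m. \<Sum>j = 1..Poly_Mapping.lookup m x. Poly_Mapping.single (x, j) 1)"


section \<open>Simplicial trees and facet ideals\<close>

definition simplicial_complex_on :: "'v set \<Rightarrow> 'v set set \<Rightarrow> bool" where
  "simplicial_complex_on V \<Delta> \<longleftrightarrow>
     finite V \<and> \<Delta> \<subseteq> Pow V \<and> (\<forall>F \<in> \<Delta>. \<forall>G \<subseteq> F. G \<in> \<Delta>) \<and> (\<forall>v \<in> V. {v} \<in> \<Delta>)"

definition facets :: "'v set set \<Rightarrow> 'v set set" where
  "facets \<Delta> = {F \<in> \<Delta>. \<forall>G \<in> \<Delta>. F \<subseteq> G \<longrightarrow> G = F}"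

definition facet_ideal :: "'v set set \<Rightarrow> ('v, 'k::comm_ring_1) mpoly set" where
  "facet_ideal \<Delta> = monomial_ideal ((\<lambda>F. \<Sum>v \<in> F. Poly_Mapping.single v 1) ` facets \<Delta>)"

definition subcollection :: "'v set set \<Rightarrow> 'v set set \<Rightarrow> bool" where
  "subcollection \<Gamma> \<Delta> \<longleftrightarrow> (\<exists>W. simplicial_complex_on W \<Gamma>) \<and> facets \<Gamma> \<subseteq> facets \<Delta>"

definition leaf :: "'v set set \<Rightarrow> 'v set \<Rightarrow> bool" where
  "leaf \<Delta> F \<longleftrightarrow>
     F \<in> facets \<Delta> \<and>
     (facets \<Delta> = {F} \<or>
      (\<exists>G \<in> facets \<Delta>. G \<noteq> F \<and> (\<forall>H \<in> facets \<Delta>. H \<noteq> F \<longrightarrow> F \<inter> H \<subseteq> G)))"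

definition connected_complex :: "'v set set \<Rightarrow> bool" where
  "connected_complex \<Delta> \<longleftrightarrow>
     (\<forall>F \<in> facets \<Delta>. \<forall>G \<in> facets \<Delta>.
        (F, G) \<in> {(A, B). A \<in> facets \<Delta> \<and> B \<in> facets \<Delta> \<and> A \<inter> B \<noteq> {}}\<^sup>*)"

definition simplicial_tree :: "'v set \<Rightarrow> 'v set set \<Rightarrow> bool" where
  "simplicial_tree V \<Delta> \<longleftrightarrow>
     simplicial_complex_on V \<Delta> \<and> connected_complex \<Delta> \<and>
     (\<forall>\<Gamma>. subcollection \<Gamma> \<Delta> \<and> \<Gamma> \<noteq> {} \<longrightarrow> (\<exists>F. leaf \<Gamma> F))"

end

theory Submission
  imports Defs "HOL-Library.Set_Algebras"
begin

text \<open>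
  Let \<open>S\<close> be the set of minimal generators of \<open>I\<close>. Divisibility properties of generators are read off
  their polarizations, so every subset of \<open>S\<close> with two or more elements has a leaf: an element \<open>m\<close> such
  that some other element \<open>g\<close>, a joint, is divisible by \<open>gcd(m, h)\<close> for all remaining \<open>h\<close>. Filter \<open>R\<close> by
  the ideals \<open>I\<^sub>c \<supseteq> I\<close> spanned by the monomials \<open>f\<close> such that \<open>I : f\<close> has height at least \<open>c\<close>.
  Every prime above the annihilator of \<open>I\<^sub>c / I\<^bsub>c+1\<^esub>\<close> contains \<open>c\<close> variables, so this module has dimension at most \<open>n - c\<close>.

  The elementary symmetric polynomials \<open>e\<^bsub>n-c\<^esub>, \<dots>, e\<^sub>1\<close> are a regular sequence on it, by induction on the
  degrees of the generators: for a leaf \<open>m\<close> with joint \<open>g\<close> and \<open>u = gcd(m, g)\<close>, or \<open>u\<close> a variable of \<open>m\<close>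
  if that is \<open>1\<close>, the formation of \<open>I\<^sub>c\<close> commutes with passing to \<open>I : u\<close> and to \<open>I + (u)\<close>,
  which are again of forest type and have smaller generators. In the end \<open>I\<close> is generated by variables, and \<open>e\<^bsub>d\<^esub>, \<dots>, e\<^sub>1\<close> is a regular sequence in a
  polynomial ring in \<open>d\<close> variables. Since the depth never exceeds the dimension, both equal \<open>n - c\<close>.
\<close>

section \<open>Regular sequences and prime chains\<close>

text \<open>Nothing is transferred back along polarization: \<open>I\<close> itself is filtered, and
  polarization serves only to read gcds and divisibility as intersection and inclusion of facets.
  I_c / I is the largest submodule of R / I of dimension at most n - c, hence the indexing by
  heights of colon ideals. The gluing step is the exact sequence 0 -> (I_c : u)/(I_{c+1} : u) ->
  I_c/I_{c+1} -> (I_c + (u))/(I_{c+1} + (u)) -> 0. Regularity passes from the ends to the middle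
  only if both ends carry the same sequence, so the sequence must depend on c alone and not on the
  ideal. Elementary symmetric polynomials do this over every field, whereas general linear forms
  would ask for an infinite one. Either end may vanish while the middle does not, so the induction
  runs with weak regularity; that the quotients kept in the end are not exhausted by the sequence
  follows from a comparison of degrees. The upper bound for the dimension comes from counting
  monomials in powers of elements that separate a chain of primes.\<close>

definition ideal_set :: "'a::comm_ring_1 set \<Rightarrow> bool" where
  "ideal_set A \<longleftrightarrow> 0 \<in> A \<and> (\<forall>x\<in>A. \<forall>y\<in>A. x + y \<in> A) \<and> (\<forall>r. \<forall>x\<in>A. r * x \<in> A)"

lemma ideal_setI:
  assumes "0 \<in> A" "\<And>x y. x \<in> A \<Longrightarrow> y \<in> A \<Longrightarrow> x + y \<in> A" "\<And>r x. x \<in> A \<Longrightarrow> r * x \<in> A"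
  shows "ideal_set A"
  using assms by (auto simp: ideal_set_def)

lemma ideal_set_zero: "ideal_set A \<Longrightarrow> 0 \<in> A"
  and ideal_set_add: "ideal_set A \<Longrightarrow> x \<in> A \<Longrightarrow> y \<in> A \<Longrightarrow> x + y \<in> A"
  and ideal_set_mult: "ideal_set A \<Longrightarrow> x \<in> A \<Longrightarrow> r * x \<in> A"
  by (auto simp: ideal_set_def)

lemma ideal_set_uminus: "ideal_set A \<Longrightarrow> x \<in> A \<Longrightarrow> - x \<in> A"
  using ideal_set_mult[of A x "-1"] by simp

lemma ideal_set_diff: "ideal_set A \<Longrightarrow> x \<in> A \<Longrightarrow> y \<in> A \<Longrightarrow> x - y \<in> A"
  using ideal_set_add[of A x "-y"] ideal_set_uminus[of A y] by simp

lemmas ideal_set_intros =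
  ideal_set_zero ideal_set_add ideal_set_mult ideal_set_uminus ideal_set_diff

lemma ideal_set_sum: "ideal_set A \<Longrightarrow> (\<And>i. i \<in> I \<Longrightarrow> f i \<in> A) \<Longrightarrow> sum f I \<in> A"
  by (induction I rule: infinite_finite_induct) (auto intro: ideal_set_intros)

lemma ideal_set_inter: "ideal_set A \<Longrightarrow> ideal_set B \<Longrightarrow> ideal_set (A \<inter> B)"
  by (auto simp: ideal_set_def)

lemma ideal_set_plus:
  assumes "ideal_set A" "ideal_set B"
  shows "ideal_set (A + B)"
proof (rule ideal_setI)
  show "0 \<in> A + B"
    using set_plus_intro[of 0 A 0 B] assms by (simp add: ideal_set_zero)
  show "x + y \<in> A + B" if "x \<in> A + B" "y \<in> A + B" for x y
  proof -
    from that obtain a b a' b' where "x = a + b" "y = a' + b'" "a \<in> A" "b \<in> B" "a' \<in> A" "b' \<in> B"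
      by (auto simp: set_plus_def)
    then have "x + y = (a + a') + (b + b')" "a + a' \<in> A" "b + b' \<in> B"
      using assms by (auto simp: algebra_simps intro: ideal_set_intros)
    then show ?thesis by (metis set_plus_intro)
  qed
  show "r * x \<in> A + B" if "x \<in> A + B" for r x
  proof -
    from that obtain a b where "x = a + b" "a \<in> A" "b \<in> B" by (auto simp: set_plus_def)
    then have "r * x = r * a + r * b" "r * a \<in> A" "r * b \<in> B"
      using assms by (auto simp: distrib_left intro: ideal_set_intros)
    then show ?thesis by (metis set_plus_intro)
  qed
qed

lemma ideal_set_elt_times: "ideal_set K \<Longrightarrow> ideal_set (t *o K)"
proof (rule ideal_setI)
  assume K: "ideal_set K"
  show "0 \<in> t *o K"
    using K by (auto simp: elt_set_times_def intro!: bexI[of _ 0] ideal_set_intros)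
  show "x + y \<in> t *o K" if "x \<in> t *o K" "y \<in> t *o K" for x y
    using that K by (auto simp: elt_set_times_def distrib_left[symmetric] intro!: bexI ideal_set_intros)
  show "r * x \<in> t *o K" if "x \<in> t *o K" for r x
    using that K by (auto simp: elt_set_times_def mult.left_commute[of r] intro!: bexI ideal_set_intros)
qed

lemma ideal_set_quotient:
  assumes "ideal_set A"
  shows "ideal_set {r. \<forall>x\<in>K. r * x \<in> A}"
  using assms by (intro ideal_setI) (auto simp: algebra_simps intro: ideal_set_intros)

lemma subset_plus_left: "0 \<in> B \<Longrightarrow> A \<subseteq> A + (B :: 'a::monoid_add set)"
  using set_plus_intro[of _ A 0 B] by fastforce

lemma plus_subset: "ideal_set B \<Longrightarrow> A \<subseteq> B \<Longrightarrow> C \<subseteq> B \<Longrightarrow> A + C \<subseteq> B"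
  by (auto simp: set_plus_def intro!: ideal_set_add)

lemma plus_elt_timesE:
  assumes "x \<in> A + t *o K"
  obtains a k where "x = a + t * k" "a \<in> A" "k \<in> K"
  using assms by (auto simp: set_plus_def elt_set_times_def)

lemma plus_elt_timesI: "a \<in> A \<Longrightarrow> k \<in> K \<Longrightarrow> a + t * k \<in> A + t *o K"
  by (auto simp: set_plus_def elt_set_times_def)

text \<open>
  The pair \<open>(A, K)\<close> stands for the module \<open>(A + K) / A\<close>; \<open>A\<close> need not be contained in \<open>K\<close>.
\<close>

primrec weakly_regular :: "'a::comm_ring_1 list \<Rightarrow> 'a set \<Rightarrow> 'a set \<Rightarrow> bool" where
  "weakly_regular [] A K \<longleftrightarrow> True"
| "weakly_regular (t # ts) A K \<longleftrightarrow>
     (\<forall>x\<in>K. t * x \<in> A \<longrightarrow> x \<in> A) \<and> weakly_regular ts (A + t *o K) K"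

primrec adjoin_multiples :: "'a::comm_ring_1 list \<Rightarrow> 'a set \<Rightarrow> 'a set \<Rightarrow> 'a set" where
  "adjoin_multiples [] A K = A"
| "adjoin_multiples (t # ts) A K = adjoin_multiples ts (A + t *o K) K"

text \<open>The module (A + K)/A is K/(A \<inter> K), so only the trace of \<open>A\<close> on
  \<open>K\<close> matters. Since tK lies in \<open>K\<close>, the modular law (A + tK) \<inter> K =
  (A \<inter> K) + tK keeps this true after each element.\<close>

lemma weakly_regular_cong:
  assumes "ideal_set K" "A \<inter> K = A' \<inter> K"
  shows "weakly_regular ts A K \<longleftrightarrow> weakly_regular ts A' K"
  using assms(2)
proof (induction ts arbitrary: A A')
  case (Cons t ts)
  have sub: "(B + t *o K) \<inter> K \<subseteq> B' + t *o K" if "B \<inter> K = B' \<inter> K" for B B'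
  proof
    fix x assume "x \<in> (B + t *o K) \<inter> K"
    then obtain b k where x: "x = b + t * k" "b \<in> B" "k \<in> K" "x \<in> K"
      by (auto elim: plus_elt_timesE)
    then have "b \<in> K"
      using ideal_set_diff[OF assms(1), of x "t * k"] ideal_set_mult[OF assms(1)] by simp
    then show "x \<in> B' + t *o K" using x that by (auto intro!: plus_elt_timesI)
  qed
  have "(A + t *o K) \<inter> K = (A' + t *o K) \<inter> K"
    using sub[of A A'] sub[of A' A] Cons.prems by blast
  then have "weakly_regular ts (A + t *o K) K \<longleftrightarrow> weakly_regular ts (A' + t *o K) K"
    by (rule Cons.IH)
  moreover have "t * x \<in> A \<longleftrightarrow> t * x \<in> A'" "x \<in> A \<longleftrightarrow> x \<in> A'" if "x \<in> K" for x
    using that Cons.prems ideal_set_mult[OF assms(1) that, of t] by blast+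
  ultimately show ?case by auto
qed simp

text \<open>Both sides concern the same module: enlarging \<open>K\<close> inside A + K does not
  change (A + K)/A.\<close>

lemma weakly_regular_absorb:
  assumes "ideal_set A" "ideal_set K" "K \<subseteq> K'" "K' \<subseteq> A + K"
  shows "weakly_regular ts A K' \<longleftrightarrow> weakly_regular ts A K"
  using assms(1,4)
proof (induction ts arbitrary: A)
  case (Cons t ts)
  have eq: "A + t *o K' = A + t *o K"
  proof
    show "A + t *o K' \<subseteq> A + t *o K"
    proof
      fix x assume "x \<in> A + t *o K'"
      then obtain a k' where x: "x = a + t * k'" "a \<in> A" "k' \<in> K'" by (rule plus_elt_timesE)
      then obtain b k where k: "k' = b + k" "b \<in> A" "k \<in> K"
        using Cons.prems(2) by (auto simp: set_plus_def)
      have "x = (a + t * b) + t * k" "a + t * b \<in> A"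
        using x k Cons.prems(1) by (auto simp: distrib_left add.assoc intro: ideal_set_intros)
      then show "x \<in> A + t *o K" using k(3) plus_elt_timesI by metis
    qed
    show "A + t *o K \<subseteq> A + t *o K'"
      using assms(3) by (auto elim!: plus_elt_timesE intro!: plus_elt_timesI)
  qed
  have I: "ideal_set (A + t *o K)"
    using Cons.prems(1) assms(2) by (intro ideal_set_plus ideal_set_elt_times)
  have "A \<subseteq> A + t *o K"
    using assms(2) by (intro subset_plus_left ideal_set_zero ideal_set_elt_times)
  then have "A + K \<subseteq> (A + t *o K) + K" by (rule set_plus_mono2) simp
  then have IH: "weakly_regular ts (A + t *o K) K' \<longleftrightarrow> weakly_regular ts (A + t *o K) K"
    using Cons.prems(2) by (intro Cons.IH I) blast
  have "(\<forall>x\<in>K'. t * x \<in> A \<longrightarrow> x \<in> A) \<longleftrightarrow> (\<forall>x\<in>K. t * x \<in> A \<longrightarrow> x \<in> A)"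
  proof (intro iffI ballI impI)
    fix x assume reg: "\<forall>x\<in>K. t * x \<in> A \<longrightarrow> x \<in> A" and x: "x \<in> K'" "t * x \<in> A"
    obtain b k where k: "x = b + k" "b \<in> A" "k \<in> K"
      using Cons.prems(2) x(1) by (auto simp: set_plus_def)
    have "t * k \<in> A"
      using x(2) k Cons.prems(1) ideal_set_diff[of A "t * x" "t * b"] ideal_set_mult[of A b t]
      by (simp add: algebra_simps)
    then show "x \<in> A" using reg k Cons.prems(1) by (auto intro: ideal_set_intros)
  qed (use assms(3) in blast)
  then show ?case using IH eq by simp
qed simp

text \<open>The exact sequence is 0 -> (A + (B \<inter> K))/A -> (A + K)/A -> (B + K)/B -> 0. It
  stays exact modulo \<open>t\<close> because \<open>t\<close> is a nonzerodivisor on the right-hand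
  module, so the elements can be treated one at a time.\<close>

lemma weakly_regular_ext:
  assumes "ideal_set A" "ideal_set B" "ideal_set K" "A \<subseteq> B"
    and "weakly_regular ts A (B \<inter> K)" "weakly_regular ts B K"
  shows "weakly_regular ts A K"
  using assms(1,2,4-)
proof (induction ts arbitrary: A B)
  case (Cons t ts)
  note K = assms(3)
  let ?A = "A + t *o K" and ?B = "B + t *o K"
  have regB: "x \<in> B" if "x \<in> K" "t * x \<in> B" for x
    using Cons.prems that by auto
  have I: "ideal_set ?A" "ideal_set ?B" "ideal_set (B \<inter> K)"
    using Cons.prems K by (auto intro: ideal_set_plus ideal_set_elt_times ideal_set_inter)
  have "weakly_regular ts (A + t *o (B \<inter> K)) (B \<inter> K)"
    using Cons.prems by simp
  \<comment> \<open>Exactness on the left modulo \<open>t\<close>: if a + tk lies in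
    \<open>B\<close>, then so does tk, and regularity on the quotient puts k into
    \<open>B\<close>.\<close>
  moreover have "(A + t *o (B \<inter> K)) \<inter> (B \<inter> K) = ?A \<inter> (B \<inter> K)"
  proof -
    have "k \<in> B" if "a \<in> A" "k \<in> K" "a + t * k \<in> B" for a k
      using that regB[of k] Cons.prems ideal_set_diff[of B "a + t * k" a] by auto
    then show ?thesis by (auto elim!: plus_elt_timesE intro!: plus_elt_timesI)
  qed
  ultimately have "weakly_regular ts ?A (B \<inter> K)"
    using weakly_regular_cong[OF I(3)] by metis
  moreover have "B \<inter> K \<subseteq> ?B \<inter> K"
    using subset_plus_left[of "t *o K" B] K
    by (auto intro: ideal_set_zero ideal_set_elt_times)
  \<comment> \<open>The kernel for the next step exceeds the old one only by multiples tk, which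
    already lie in \<open>?A\<close>.\<close>
  moreover have "?B \<inter> K \<subseteq> ?A + (B \<inter> K)"
  proof
    fix x assume "x \<in> ?B \<inter> K"
    then obtain b k where x: "x = b + t * k" "b \<in> B" "k \<in> K" "x \<in> K"
      by (auto elim: plus_elt_timesE)
    then have "b \<in> B \<inter> K"
      using ideal_set_diff[OF K, of x "t * k"] ideal_set_mult[OF K] by simp
    moreover have "t * k \<in> ?A"
      using plus_elt_timesI[of 0 A k K t] x Cons.prems by (auto intro: ideal_set_zero)
    ultimately show "x \<in> ?A + (B \<inter> K)"
      using x(1) by (metis add.commute set_plus_intro)
  qed
  ultimately have "weakly_regular ts ?A (?B \<inter> K)"
    using weakly_regular_absorb[OF I(1) I(3)] by blast
  moreover have "?A \<subseteq> ?B" using Cons.prems by (intro set_plus_mono2) auto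
  moreover have "weakly_regular ts ?B K" using Cons.prems by simp
  ultimately have "weakly_regular ts ?A K" by (intro Cons.IH[of ?A ?B] I)
  moreover have "\<forall>x\<in>K. t * x \<in> A \<longrightarrow> x \<in> A"
  proof (intro ballI impI)
    fix x assume x: "x \<in> K" "t * x \<in> A"
    then have "x \<in> B" using regB Cons.prems by auto
    then show "x \<in> A" using x Cons.prems by auto
  qed
  ultimately show ?case by simp
qed simp

text \<open>Multiplication by \<open>u\<close> induces an isomorphism from (K + (A : u))/(A : u)
  onto (A + uK)/A.\<close>

lemma weakly_regular_colon:
  assumes "ideal_set A" "ideal_set K" "weakly_regular ts {x. u * x \<in> A} K"
  shows "weakly_regular ts A (u *o K)"
  using assms(1,3)
proof (induction ts arbitrary: A)
  case (Cons t ts)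
  let ?A = "A + t *o (u *o K)"
  have I: "ideal_set ?A"
    using Cons.prems assms(2) by (intro ideal_set_plus ideal_set_elt_times)
  have eq: "{x. u * x \<in> ?A} = {x. u * x \<in> A} + t *o K"
  proof (intro equalityI subsetI)
    fix x assume "x \<in> {x. u * x \<in> ?A}"
    then obtain a k where *: "u * x = a + t * (u * k)" "a \<in> A" "k \<in> K"
      by (auto simp: set_plus_def elt_set_times_def)
    then have "u * (x - t * k) = a" by (simp add: algebra_simps)
    then have "x - t * k \<in> {x. u * x \<in> A}" using * by simp
    from plus_elt_timesI[OF this *(3), of t] show "x \<in> {x. u * x \<in> A} + t *o K" by simp
  next
    fix x assume "x \<in> {x. u * x \<in> A} + t *o K"
    then obtain y k where "x = y + t * k" "u * y \<in> A" "k \<in> K"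
      by (auto elim!: plus_elt_timesE)
    then have "u * x = u * y + t * (u * k)" "u * y \<in> A" "u * k \<in> u *o K"
      by (auto simp: algebra_simps elt_set_times_def)
    then show "x \<in> {x. u * x \<in> ?A}" using plus_elt_timesI by simp
  qed
  have "weakly_regular ts ?A (u *o K)"
    using Cons.prems by (intro Cons.IH I) (auto simp: eq)
  moreover have "\<forall>x\<in>u *o K. t * x \<in> A \<longrightarrow> x \<in> A"
    using Cons.prems by (auto simp: elt_set_times_def mult.left_commute)
  ultimately show ?case by simp
qed simp

lemma weakly_regular_trivial: "ideal_set A \<Longrightarrow> ideal_set K \<Longrightarrow> K \<subseteq> A \<Longrightarrow> weakly_regular ts A K"
proof (induction ts arbitrary: A)
  case (Cons t ts)
  have "A \<subseteq> A + t *o K"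
    using Cons.prems by (intro subset_plus_left ideal_set_zero ideal_set_elt_times)
  then show ?case using Cons by (auto intro!: Cons.IH ideal_set_plus ideal_set_elt_times)
qed simp

lemma weakly_regular_nth:
  "weakly_regular ts A K \<longleftrightarrow>
     (\<forall>i<length ts. \<forall>x\<in>K. ts ! i * x \<in> adjoin_multiples (take i ts) A K \<longrightarrow>
        x \<in> adjoin_multiples (take i ts) A K)"
proof (induction ts arbitrary: A)
  case (Cons t ts)
  show ?case by (simp add: Cons.IH All_less_Suc2)
qed simp

lemma ideal_set_adjoin_multiples:
  "ideal_set A \<Longrightarrow> ideal_set K \<Longrightarrow> ideal_set (adjoin_multiples ts A K)"
  by (induction ts arbitrary: A) (auto intro: ideal_set_plus ideal_set_elt_times)

text \<open>This universal property matches the recursive construction with the intersection of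
  submodules that defines \<open>ideal_smult\<close>.\<close>

lemma adjoin_multiples_least:
  assumes "ideal_set A" "ideal_set K" "ideal_set N"
  shows "adjoin_multiples ts A K \<subseteq> N \<longleftrightarrow> A \<subseteq> N \<and> (\<forall>t\<in>set ts. \<forall>x\<in>K. t * x \<in> N)"
  using assms(1)
proof (induction ts arbitrary: A)
  case (Cons t ts)
  have "A + t *o K \<subseteq> N \<longleftrightarrow> A \<subseteq> N \<and> (\<forall>x\<in>K. t * x \<in> N)"
  proof
    assume *: "A + t *o K \<subseteq> N"
    have "A \<subseteq> A + t *o K"
      using assms by (intro subset_plus_left ideal_set_zero ideal_set_elt_times)
    moreover have "t * x \<in> A + t *o K" if "x \<in> K" for x
      using plus_elt_timesI[of 0 A x K t] that Cons.prems by (auto intro: ideal_set_zero)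
    ultimately show "A \<subseteq> N \<and> (\<forall>x\<in>K. t * x \<in> N)" using * by blast
  next
    assume "A \<subseteq> N \<and> (\<forall>x\<in>K. t * x \<in> N)"
    then show "A + t *o K \<subseteq> N"
      by (intro plus_subset assms) (auto simp: elt_set_times_def)
  qed
  moreover have "ideal_set (A + t *o K)"
    using Cons.prems assms(2) by (intro ideal_set_plus ideal_set_elt_times)
  ultimately show ?case using Cons.IH[of "A + t *o K"] by simp
qed simp

section \<open>Prime ideals, and why depth is at most dimension\<close>

definition prime_ideal_set :: "'a::comm_ring_1 set \<Rightarrow> bool" where
  "prime_ideal_set P \<longleftrightarrow>
     ideal_set P \<and> 1 \<notin> P \<and> (\<forall>a b. a * b \<in> P \<longrightarrow> a \<in> P \<or> b \<in> P)"

lemma prime_ideal_setD: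
  assumes "prime_ideal_set P"
  shows "ideal_set P" "1 \<notin> P" "a * b \<in> P \<Longrightarrow> a \<in> P \<or> b \<in> P"
  using assms by (auto simp: prime_ideal_set_def)

lemma prime_ideal_set_power: "prime_ideal_set P \<Longrightarrow> a ^ n \<in> P \<Longrightarrow> a \<in> P"
  by (induction n) (auto dest: prime_ideal_setD)

lemma prime_ideal_set_prod:
  "finite I \<Longrightarrow> prime_ideal_set P \<Longrightarrow> (\<Prod>x\<in>I. f x) \<in> P \<Longrightarrow> \<exists>x\<in>I. f x \<in> P"
proof (induction I rule: finite_induct)
  case empty
  then show ?case using prime_ideal_setD(2) by auto
next
  case (insert x I)
  then show ?case using prime_ideal_setD(3)[of P "f x" "\<Prod>x\<in>I. f x"] by auto
qed

text \<open>An ideal that is maximal among those disjoint from the multiplicative set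
  \<open>W\<close> is prime. Taking \<open>W = {1}\<close> gives a prime over a proper ideal; other
  choices replace localization.\<close>

lemma exists_prime_ideal_set_avoiding:
  assumes "ideal_set J" "1 \<in> W" "\<And>a b. a \<in> W \<Longrightarrow> b \<in> W \<Longrightarrow> a * b \<in> W" "J \<inter> W = {}"
  obtains P where "prime_ideal_set P" "J \<subseteq> P" "P \<inter> W = {}"
proof -
  let ?S = "{A. ideal_set A \<and> J \<subseteq> A \<and> A \<inter> W = {}}"
  have "\<exists>M\<in>?S. \<forall>Z\<in>?S. M \<subseteq> Z \<longrightarrow> Z = M"
  proof (rule subset_Zorn_nonempty)
    show "?S \<noteq> {}" using assms by auto
    fix C assume C: "C \<noteq> {}" "subset.chain ?S C"
    have CS: "C \<subseteq> ?S" and lin: "\<And>Z Y. Z \<in> C \<Longrightarrow> Y \<in> C \<Longrightarrow> Z \<subseteq> Y \<or> Y \<subseteq> Z"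
      using C(2) unfolding subset.chain_def by blast+
    have "ideal_set (\<Union>C)"
    proof (rule ideal_setI)
      show "0 \<in> \<Union>C" using C(1) CS by (auto intro: ideal_set_zero)
      fix x y assume "x \<in> \<Union>C" "y \<in> \<Union>C"
      then obtain Z Y where "Z \<in> C" "Y \<in> C" "x \<in> Z" "y \<in> Y" by auto
      then obtain U where "U \<in> C" "x \<in> U" "y \<in> U" using lin[of Z Y] by blast
      then show "x + y \<in> \<Union>C" using CS by (auto intro!: bexI[of _ U] ideal_set_add)
    next
      fix r x assume "x \<in> \<Union>C"
      then show "r * x \<in> \<Union>C" using CS by (auto intro!: ideal_set_mult)
    qed
    then show "\<Union>C \<in> ?S" using C(1) CS by auto
  qed
  then obtain P where "P \<in> ?S" and "\<forall>Z\<in>?S. P \<subseteq> Z \<longrightarrow> Z = P" by (rule bexE)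
  then have P: "ideal_set P" "J \<subseteq> P" "P \<inter> W = {}"
    and max: "\<And>Z. ideal_set Z \<Longrightarrow> J \<subseteq> Z \<Longrightarrow> Z \<inter> W = {} \<Longrightarrow> P \<subseteq> Z \<Longrightarrow> Z = P"
    by simp_all
  have ext: "\<exists>p r. p \<in> P \<and> p + a * r \<in> W" if "a \<notin> P" for a
  proof -
    let ?Z = "P + a *o UNIV"
    have I: "ideal_set ?Z" using P(1) by (intro ideal_set_plus ideal_set_elt_times) (auto simp: ideal_set_def)
    have sub: "P \<subseteq> ?Z" by (rule subset_plus_left) (auto simp: elt_set_times_def intro: exI[of _ 0])
    have "0 + a * 1 \<in> ?Z" using P(1) by (intro plus_elt_timesI) (auto intro: ideal_set_zero)
    then have "?Z \<noteq> P" using that by auto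
    then have "?Z \<inter> W \<noteq> {}" using max[OF I] P(2) sub by blast
    then show ?thesis by (auto elim!: plus_elt_timesE)
  qed
  have "prime_ideal_set P"
    unfolding prime_ideal_set_def
  proof (intro conjI allI impI P(1))
    show "1 \<notin> P" using P(3) assms(2) by auto
    fix a b assume ab: "a * b \<in> P"
    show "a \<in> P \<or> b \<in> P"
    proof (rule ccontr)
      assume "\<not> (a \<in> P \<or> b \<in> P)"
      then obtain p r q s where pq: "p \<in> P" "p + a * r \<in> W" "q \<in> P" "q + b * s \<in> W"
        using ext by metis
      have "(p + a * r) * (q + b * s) = (q + b * s) * p + (a * r) * q + (r * s) * (a * b)"
        by (simp add: algebra_simps)
      also have "\<dots> \<in> P" 
        using ideal_set_mult[OF P(1) ab, of "r * s"] pq P(1)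
        by (intro ideal_set_add[OF P(1)]) (auto intro: ideal_set_mult)
      finally show False using pq assms(3) P(3) by blast
    qed
  qed
  then show thesis using that P by blast
qed

text \<open>
  This yields depth \<open>\<le>\<close> dimension: below a prime containing the annihilator of \<open>K / (A + tK)\<close>
  there is one avoiding \<open>t\<close> and containing the annihilator of \<open>K / A\<close>, because \<open>t\<close> is a nonzerodivisor.
\<close>

lemma weakly_regular_prime_chain:
  assumes "ideal_set A" "ideal_set K" "weakly_regular ts A K" "\<not> K \<subseteq> adjoin_multiples ts A K"
  shows "\<exists>P. (\<forall>i\<le>length ts. prime_ideal_set (P i) \<and> {r. \<forall>x\<in>K. r * x \<in> A} \<subseteq> P i) \<and>
             (\<forall>i<length ts. P i \<subset> P (Suc i))"
  using assms(1,3,4)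
proof (induction ts arbitrary: A)
  case Nil
  let ?J = "{r. \<forall>x\<in>K. r * x \<in> A}"
  have "?J \<inter> {1} = {}" using Nil.prems by auto
  then obtain P where "prime_ideal_set P" "?J \<subseteq> P"
    using exists_prime_ideal_set_avoiding[OF ideal_set_quotient[OF Nil.prems(1)], of "{1}" K] by auto
  then show ?case by auto
next
  case (Cons t ts)
  let ?A = "A + t *o K"
  let ?J = "{r. \<forall>x\<in>K. r * x \<in> A}" and ?J' = "{r. \<forall>x\<in>K. r * x \<in> ?A}"
  have I: "ideal_set ?A" using Cons.prems assms(2) by (intro ideal_set_plus ideal_set_elt_times)
  have "A \<subseteq> ?A" using assms(2) by (intro subset_plus_left ideal_set_zero ideal_set_elt_times)
  then have JJ': "?J \<subseteq> ?J'" by auto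
  have tJ': "t \<in> ?J'"
    using plus_elt_timesI[of 0 A _ K t] Cons.prems(1) by (auto intro: ideal_set_zero)
  have "weakly_regular ts ?A K" "\<not> K \<subseteq> adjoin_multiples ts ?A K" using Cons.prems by auto
  from Cons.IH[OF I this] obtain P where
    P: "\<And>i. i \<le> length ts \<Longrightarrow> prime_ideal_set (P i) \<and> ?J' \<subseteq> P i" "\<And>i. i < length ts \<Longrightarrow> P i \<subset> P (Suc i)"
    by blast
  have P0: "prime_ideal_set (P 0)" "?J' \<subseteq> P 0" using P(1) by auto
  \<comment> \<open>A prime disjoint from \<open>?W\<close> lies in \<open>P 0\<close> (case i = 0)
    and omits \<open>t\<close> (case s = 1). As \<open>t\<close> belongs to \<open>P 0\<close>, the
    inclusion is strict and the chain grows by one at its lower end.\<close>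
  let ?W = "{s * t ^ i | s i. s \<notin> P 0}"
  have pow: "s \<in> ?J" if "s * t ^ i \<in> ?J" for s i
    using that
  proof (induction i)
    case (Suc i)
    have "s * t ^ i * x \<in> A" if "x \<in> K" for x
    proof -
      have "t * (s * t ^ i * x) \<in> A" using Suc.prems that by (auto simp: algebra_simps)
      moreover have "s * t ^ i * x \<in> K" using that assms(2) by (intro ideal_set_mult)
      ultimately show ?thesis using Cons.prems(2) by simp
    qed
    then show ?case using Suc.IH by blast
  qed simp
  have "s * t ^ i \<notin> ?J" if "s \<notin> P 0" for s i using pow[of s i] JJ' P0(2) that by blast
  then have disj: "?J \<inter> ?W = {}" by blast
  have "1 * t ^ 0 \<in> ?W" using prime_ideal_setD(2)[OF P0(1)] by blast
  then have one: "1 \<in> ?W" by simp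
  have mult: "a * b \<in> ?W" if a: "a \<in> ?W" and b: "b \<in> ?W" for a b
  proof -
    from a obtain s i where "a = s * t ^ i" "s \<notin> P 0" by blast
    moreover from b obtain s' i' where "b = s' * t ^ i'" "s' \<notin> P 0" by blast
    ultimately have "a * b = (s * s') * t ^ (i + i')" "s * s' \<notin> P 0"
      using prime_ideal_setD(3)[OF P0(1)] by (auto simp: power_add algebra_simps)
    then show ?thesis by blast
  qed
  obtain Q where Q: "prime_ideal_set Q" "?J \<subseteq> Q" "Q \<inter> ?W = {}"
    by (rule exists_prime_ideal_set_avoiding[OF ideal_set_quotient[OF Cons.prems(1)] one mult disj])
  have "Q \<subseteq> P 0"
  proof
    fix s assume "s \<in> Q"
    then have "s * t ^ 0 \<notin> ?W" using Q(3) by auto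
    then show "s \<in> P 0" by blast
  qed
  moreover have "t \<notin> Q"
  proof -
    have "1 * t ^ 1 \<in> ?W" using prime_ideal_setD(2)[OF P0(1)] by blast
    then show ?thesis using Q(3) by auto
  qed
  ultimately have "Q \<subset> P 0" using tJ' P0(2) by blast
  define P' where "P' = case_nat Q P"
  have "prime_ideal_set (P' i) \<and> ?J \<subseteq> P' i" if "i \<le> length (t # ts)" for i
  proof (cases i)
    case (Suc j)
    then show ?thesis using that P(1)[of j] JJ' by (simp add: P'_def) blast
  qed (use Q in \<open>simp add: P'_def\<close>)
  moreover have "P' i \<subset> P' (Suc i)" if "i < length (t # ts)" for i
    using that \<open>Q \<subset> P 0\<close> P(2) by (cases i) (auto simp: P'_def)
  ultimately show ?case by blast
qed

section \<open>Monomial ideals\<close>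

text \<open>Ideals are represented by their sets of exponent vectors: sums, intersections and colons
  by monomials then become unions, intersections and shifts of sets.\<close>

definition monomial_span :: "('x \<Rightarrow>\<^sub>0 nat) set \<Rightarrow> ('x, 'k::comm_ring_1) mpoly set" where
  "monomial_span U = {p. Poly_Mapping.keys p \<subseteq> U}"

definition multiples :: "('x \<Rightarrow>\<^sub>0 nat) \<Rightarrow> ('x \<Rightarrow>\<^sub>0 nat) set" where
  "multiples m = range ((+) m)"

definition upward_closed :: "('x \<Rightarrow>\<^sub>0 nat) set \<Rightarrow> bool" where
  "upward_closed U \<longleftrightarrow> (\<forall>f\<in>U. \<forall>g. f + g \<in> U)"

lemma multiples_iff:
  "f \<in> multiples m \<longleftrightarrow> (\<forall>x. Poly_Mapping.lookup m x \<le> Poly_Mapping.lookup f x)"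
proof
  assume *: "\<forall>x. Poly_Mapping.lookup m x \<le> Poly_Mapping.lookup f x"
  have "f = m + (f - m)"
    using * by (intro poly_mapping_eqI) (simp add: lookup_add lookup_minus)
  then show "f \<in> multiples m" unfolding multiples_def by (rule range_eqI)
qed (auto simp: multiples_def lookup_add)

lemma monomial_span_UNIV [simp]: "monomial_span UNIV = UNIV"
  by (simp add: monomial_span_def)

lemma monomial_span_mono: "U \<subseteq> V \<Longrightarrow> monomial_span U \<subseteq> monomial_span V"
  by (auto simp: monomial_span_def)

lemma monomial_span_inter: "monomial_span U \<inter> monomial_span V = monomial_span (U \<inter> V)"
  by (auto simp: monomial_span_def)

lemma single_in_monomial_span [simp]:
  "Poly_Mapping.single m (1 :: 'k::comm_ring_1) \<in> monomial_span U \<longleftrightarrow> m \<in> U"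
  by (simp add: monomial_span_def)

lemma upward_closed_multiples: "upward_closed (multiples m)"
  by (auto simp: upward_closed_def multiples_def add.assoc)

lemma upward_closed_Un: "upward_closed U \<Longrightarrow> upward_closed V \<Longrightarrow> upward_closed (U \<union> V)"
  by (auto simp: upward_closed_def)

lemma upward_closed_shift: "upward_closed U \<Longrightarrow> upward_closed {f. m + f \<in> U}"
  by (auto simp: upward_closed_def add.assoc[symmetric])

lemma upward_closed_UNIV [simp]: "upward_closed UNIV"
  by (simp add: upward_closed_def)

lemma ideal_set_UNIV [simp]: "ideal_set UNIV"
  by (simp add: ideal_set_def)

lemma ideal_set_monomial_span:
  fixes U :: "('x \<Rightarrow>\<^sub>0 nat) set"
  assumes "upward_closed U"
  shows "ideal_set (monomial_span U :: ('x, 'k::comm_ring_1) mpoly set)"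
proof (rule ideal_setI)
  fix p q :: "('x, 'k) mpoly"
  show "p + q \<in> monomial_span U" if "p \<in> monomial_span U" "q \<in> monomial_span U"
    using that Poly_Mapping.keys_add[of p q] by (auto simp: monomial_span_def)
  show "p * q \<in> monomial_span U" if "q \<in> monomial_span U"
  proof -
    have "a + b \<in> U" if "b \<in> U" for a b
      using assms that by (auto simp: upward_closed_def add.commute[of a])
    then show ?thesis using that keys_mult[of p q] by (fastforce simp: monomial_span_def)
  qed
qed (simp add: monomial_span_def)

lemma monomial_span_plus:
  fixes U V :: "('x \<Rightarrow>\<^sub>0 nat) set"
  shows "monomial_span U + monomial_span V = (monomial_span (U \<union> V) :: ('x, 'k::comm_ring_1) mpoly set)"
proof (intro equalityI subsetI)
  fix p :: "('x, 'k) mpoly" assume "p \<in> monomial_span U + monomial_span V"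
  then obtain a b where "p = a + b" "a \<in> monomial_span U" "b \<in> monomial_span V"
    by (auto simp: set_plus_def)
  then show "p \<in> monomial_span (U \<union> V)"
    using Poly_Mapping.keys_add[of a b] by (auto simp: monomial_span_def)
next
  fix p :: "('x, 'k) mpoly" assume p: "p \<in> monomial_span (U \<union> V)"
  define a where "a = Poly_Mapping.mapp (\<lambda>k v. v when k \<in> U) p"
  define b where "b = Poly_Mapping.mapp (\<lambda>k v. v when k \<notin> U) p"
  have "p = a + b"
    by (rule poly_mapping_eqI)
      (auto simp: a_def b_def lookup_add lookup_mapp when_def in_keys_iff)
  moreover have "a \<in> monomial_span U" "b \<in> monomial_span V"
    using p by (auto simp: a_def b_def monomial_span_def in_keys_iff lookup_mapp when_def
        split: if_splits)
  ultimately show "p \<in> monomial_span U + monomial_span V" by (metis set_plus_intro)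
qed

lemma lookup_single_mult:
  fixes p :: "('x, 'k::comm_ring_1) mpoly"
  shows "Poly_Mapping.lookup (Poly_Mapping.single m c * p) (m + f) = c * Poly_Mapping.lookup p f"
  by (simp add: lookup_mult lookup_single when_mult)

lemma keys_single_one_mult:
  fixes p :: "('x, 'k::comm_ring_1) mpoly"
  shows "Poly_Mapping.keys (Poly_Mapping.single m 1 * p) = (+) m ` Poly_Mapping.keys p"
proof
  show "Poly_Mapping.keys (Poly_Mapping.single m 1 * p) \<subseteq> (+) m ` Poly_Mapping.keys p"
    using keys_mult[of "Poly_Mapping.single m 1" p] by auto
  show "(+) m ` Poly_Mapping.keys p \<subseteq> Poly_Mapping.keys (Poly_Mapping.single m 1 * p)"
    by (auto simp: in_keys_iff lookup_single_mult)
qed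

lemma monomial_span_colon:
  "{p. Poly_Mapping.single m 1 * p \<in> monomial_span U} = monomial_span {f. m + f \<in> U}"
  by (auto simp: monomial_span_def keys_single_one_mult)

text \<open>The identity m(J : m) = J \<inter> (m) for J = \<open>monomial_span U\<close>; it
  describes the kernel in the exact sequence for a shedding monomial.\<close>

lemma elt_times_monomial_span:
  fixes U :: "('x \<Rightarrow>\<^sub>0 nat) set"
  shows "(Poly_Mapping.single m 1 :: ('x, 'k::comm_ring_1) mpoly) *o monomial_span {f. m + f \<in> U} =
    monomial_span (U \<inter> multiples m)"
proof (intro equalityI subsetI)
  fix p :: "('x, 'k) mpoly" assume p: "p \<in> monomial_span (U \<inter> multiples m)"
  have inj: "inj ((+) m)" by (simp add: inj_def)
  define q where "q = Poly_Mapping.map_key ((+) m) p"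
  have look: "Poly_Mapping.lookup q f = Poly_Mapping.lookup p (m + f)" for f
    using inj by (simp add: q_def map_key.rep_eq)
  have "p = Poly_Mapping.single m 1 * q"
  proof (rule poly_mapping_eqI)
    fix k show "Poly_Mapping.lookup p k = Poly_Mapping.lookup (Poly_Mapping.single m 1 * q) k"
    proof (cases "k \<in> multiples m")
      case True
      then show ?thesis by (auto simp: multiples_def lookup_single_mult look)
    next
      case False
      then have "k \<notin> Poly_Mapping.keys p" "k \<notin> Poly_Mapping.keys (Poly_Mapping.single m 1 * q)"
        using p by (auto simp: monomial_span_def keys_single_one_mult multiples_def)
      then show ?thesis by (simp add: in_keys_iff)
    qed
  qed
  moreover have "q \<in> monomial_span {f. m + f \<in> U}"
    using p by (auto simp: monomial_span_def in_keys_iff look)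
  ultimately show "p \<in> Poly_Mapping.single m 1 *o monomial_span {f. m + f \<in> U}"
    by (auto simp: elt_set_times_def)
qed (auto simp: elt_set_times_def monomial_span_def keys_single_one_mult multiples_def)

lemma elt_times_UNIV: "Poly_Mapping.single m 1 *o UNIV = monomial_span (multiples m)"
  using elt_times_monomial_span[of m UNIV] by simp

section \<open>Elementary symmetric polynomials\<close>

definition squarefree_monomial :: "'x set \<Rightarrow> 'x \<Rightarrow>\<^sub>0 nat" where
  "squarefree_monomial T = (\<Sum>x\<in>T. Poly_Mapping.single x 1)"

lemma lookup_squarefree_monomial:
  "finite T \<Longrightarrow> Poly_Mapping.lookup (squarefree_monomial T) x = (if x \<in> T then 1 else 0)"
  by (simp add: squarefree_monomial_def lookup_sum lookup_single when_def)

definition elementary_symmetric :: "nat \<Rightarrow> ('x::finite, 'k::comm_ring_1) mpoly" where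
  "elementary_symmetric j = (\<Sum>T | card T = j. Poly_Mapping.single (squarefree_monomial T) 1)"

text \<open>The order is decreasing because modulo all but j variables e_j is a single monomial, so
  that the first quotient is again defined by monomials.\<close>

primrec elementary_symmetrics :: "nat \<Rightarrow> ('x::finite, 'k::comm_ring_1) mpoly list" where
  "elementary_symmetrics 0 = []"
| "elementary_symmetrics (Suc j) = elementary_symmetric (Suc j) # elementary_symmetrics j"

lemma length_elementary_symmetrics [simp]: "length (elementary_symmetrics j) = j"
  by (induction j) auto

lemma set_elementary_symmetrics: "set (elementary_symmetrics j) = elementary_symmetric ` {1..j}"
  by (induction j) (auto simp: atLeastAtMostSuc_conv)

text \<open>\<open>monomial_span (meets Z)\<close> is the prime ideal generated by the variables in
  \<open>Z\<close> when the coefficients form a field.\<close>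

definition meets :: "'x set \<Rightarrow> ('x \<Rightarrow>\<^sub>0 nat) set" where
  "meets Z = {f. \<exists>x\<in>Z. Poly_Mapping.lookup f x > 0}"

lemma upward_closed_meets: "upward_closed (meets Z)"
  by (auto simp: upward_closed_def meets_def lookup_add)

text \<open>A set of the same size as \<open>- Z\<close> but different from it contains an element
  of \<open>Z\<close>, so its monomial dies modulo these variables.\<close>

lemma elementary_symmetric_mod_variables:
  fixes Z :: "'x::finite set"
  assumes "card (- Z) = j"
  obtains r :: "('x, 'k::comm_ring_1) mpoly"
  where "r \<in> monomial_span (meets Z)"
    "elementary_symmetric j = Poly_Mapping.single (squarefree_monomial (- Z)) 1 + r"
proof -
  let ?s = "\<lambda>T. Poly_Mapping.single (squarefree_monomial T) (1::'k)"
  let ?r = "\<Sum>T\<in>{T. card T = j} - {- Z}. ?s T"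
  have "?s T \<in> monomial_span (meets Z)" if "card T = j" "T \<noteq> - Z" for T
  proof -
    have "\<not> T \<subseteq> - Z" using that assms card_subset_eq[of "- Z" T] by auto
    then show ?thesis by (auto simp: meets_def lookup_squarefree_monomial)
  qed
  then have "?r \<in> monomial_span (meets Z)"
    by (intro ideal_set_sum ideal_set_monomial_span upward_closed_meets) auto
  moreover have "elementary_symmetric j = ?s (- Z) + ?r"
    using assms by (simp add: elementary_symmetric_def sum.remove)
  ultimately show thesis by (rule that)
qed

text \<open>Variables are split off the product one at a time. Modulo \<open>Z\<close> and yx_G,
  where x_G is the product over \<open>G\<close>, the submodule generated by y is R / (Z, x_G), and
  the quotient by it is R / (Z, y). The empty product leaves the zero module.\<close>

lemma weakly_regular_mod_squarefree_monomial:
  fixes Z G :: "'x::finite set" and ts :: "('x, 'k::comm_ring_1) mpoly list"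
  assumes "\<And>y. y \<in> G \<Longrightarrow> weakly_regular ts (monomial_span (meets (insert y Z))) UNIV"
    and "G \<inter> Z = {}"
  shows "weakly_regular ts (monomial_span (meets Z \<union> multiples (squarefree_monomial G))) UNIV"
  using finite[of G] assms
proof (induction G rule: finite_induct)
  case empty
  have "multiples (squarefree_monomial {} :: 'x \<Rightarrow>\<^sub>0 nat) = UNIV"
    by (auto simp: multiples_iff squarefree_monomial_def)
  then show ?case by (simp add: weakly_regular_trivial)
next
  case (insert y G)
  let ?m = "squarefree_monomial (insert y G)" and ?y = "Poly_Mapping.single y (1::nat)"
  let ?A = "monomial_span (meets Z \<union> multiples ?m) :: ('x, 'k) mpoly set"
  let ?B = "monomial_span (meets (insert y Z)) :: ('x, 'k) mpoly set"
  have I: "ideal_set ?A" "ideal_set ?B"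
    by (intro ideal_set_monomial_span upward_closed_Un upward_closed_meets upward_closed_multiples)+
  have m: "?m = ?y + squarefree_monomial G"
    using insert by (simp add: squarefree_monomial_def)
  have "multiples ?y = {f. 0 < Poly_Mapping.lookup f y}"
    by (auto simp: multiples_iff lookup_single when_def Suc_le_eq split: if_splits)
  then have meq: "meets (insert y Z) = meets Z \<union> multiples ?y"
    by (auto simp: meets_def)
  have "multiples ?m \<subseteq> multiples ?y" by (auto simp: m multiples_def add.assoc)
  then have sub: "?A \<subseteq> ?B" by (intro monomial_span_mono) (auto simp: meq)
  have "{f. ?y + f \<in> meets Z \<union> multiples ?m} = meets Z \<union> multiples (squarefree_monomial G)"
    using insert.prems(2) by (auto simp: meets_def multiples_def lookup_add lookup_single when_def m add.assoc)
  then have "{p. Poly_Mapping.single ?y 1 * p \<in> ?A} =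
      monomial_span (meets Z \<union> multiples (squarefree_monomial G))"
    by (simp add: monomial_span_colon)
  then have "weakly_regular ts ?A (Poly_Mapping.single ?y 1 *o UNIV)"
    using insert.IH insert.prems by (intro weakly_regular_colon I) auto
  moreover have "?B \<subseteq> ?A + Poly_Mapping.single ?y 1 *o UNIV"
    unfolding elt_times_UNIV monomial_span_plus by (intro monomial_span_mono) (auto simp: meq)
  moreover have "Poly_Mapping.single ?y 1 *o UNIV \<subseteq> ?B"
    unfolding elt_times_UNIV by (intro monomial_span_mono) (auto simp: meq)
  ultimately have "weakly_regular ts ?A ?B"
    using weakly_regular_absorb[OF I(1) ideal_set_elt_times[OF ideal_set_UNIV]] by blast
  moreover have "weakly_regular ts ?B UNIV" using insert.prems(1)[of y] by simp
  ultimately show ?case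
    using weakly_regular_ext[OF I ideal_set_UNIV sub] by simp
qed

text \<open>Modulo the variables in \<open>Z\<close>, the first element is the product of all others
  and thus a nonzerodivisor. Dividing it out leaves a module glued from quotients with one more
  variable killed, to which the induction hypothesis applies.\<close>

lemma weakly_regular_elementary_symmetrics:
  fixes Z :: "'x::finite set"
  assumes "card (- Z) = j"
  shows "weakly_regular (elementary_symmetrics j :: ('x, 'k::comm_ring_1) mpoly list)
           (monomial_span (meets Z)) UNIV"
  using assms
proof (induction j arbitrary: Z)
  case (Suc j)
  let ?A = "monomial_span (meets Z) :: ('x, 'k) mpoly set"
  let ?m = "squarefree_monomial (- Z)"
  have A: "ideal_set ?A" by (intro ideal_set_monomial_span upward_closed_meets)
  obtain r :: "('x, 'k) mpoly" where r: "r \<in> ?A"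
    and e: "elementary_symmetric (Suc j) = Poly_Mapping.single ?m 1 + r"
    using elementary_symmetric_mod_variables[OF Suc.prems] .
  have rp: "r * p \<in> ?A" for p using ideal_set_mult[OF A r, of p] by (simp add: mult.commute)
  have "p \<in> ?A" if "elementary_symmetric (Suc j) * p \<in> ?A" for p
  proof -
    have "Poly_Mapping.single ?m 1 * p \<in> ?A"
      using ideal_set_diff[OF A that rp[of p]] by (simp add: e distrib_right)
    then have "p \<in> monomial_span {f. ?m + f \<in> meets Z}"
      by (simp add: monomial_span_colon[symmetric])
    moreover have "{f. ?m + f \<in> meets Z} = meets Z"
      by (auto simp: meets_def lookup_add lookup_squarefree_monomial)
    ultimately show ?thesis by simp
  qed
  moreover have "?A + elementary_symmetric (Suc j) *o UNIV = monomial_span (meets Z \<union> multiples ?m)"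
  proof -
    \<comment> \<open>Multiples of \<open>r\<close> can be moved into \<open>?A\<close>, so only the
      surviving monomial counts.\<close>
    have "?A + elementary_symmetric (Suc j) *o UNIV = ?A + Poly_Mapping.single ?m 1 *o UNIV"
    proof (intro equalityI subsetI)
      fix p assume "p \<in> ?A + elementary_symmetric (Suc j) *o UNIV"
      then obtain a q where "p = a + elementary_symmetric (Suc j) * q" "a \<in> ?A"
        by (rule plus_elt_timesE)
      then have "p = (a + r * q) + Poly_Mapping.single ?m 1 * q" "a + r * q \<in> ?A"
        using rp A by (auto simp: e algebra_simps intro: ideal_set_intros)
      then show "p \<in> ?A + Poly_Mapping.single ?m 1 *o UNIV" using plus_elt_timesI by blast
    next
      fix p assume "p \<in> ?A + Poly_Mapping.single ?m 1 *o UNIV"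
      then obtain a q where "p = a + Poly_Mapping.single ?m 1 * q" "a \<in> ?A"
        by (rule plus_elt_timesE)
      then have "p = (a - r * q) + elementary_symmetric (Suc j) * q" "a - r * q \<in> ?A"
        using rp A by (auto simp: e algebra_simps intro: ideal_set_intros)
      then show "p \<in> ?A + elementary_symmetric (Suc j) *o UNIV" using plus_elt_timesI by blast
    qed
    then show ?thesis by (simp add: elt_times_UNIV monomial_span_plus)
  qed
  moreover have "weakly_regular (elementary_symmetrics j)
      (monomial_span (meets Z \<union> multiples ?m) :: ('x, 'k) mpoly set) UNIV"
  proof (rule weakly_regular_mod_squarefree_monomial)
    fix y assume "y \<in> - Z"
    then have "card (- insert y Z) = j"
      using Suc.prems card_Diff_singleton[of y "- Z"] by (simp add: Compl_insert)
    then show "weakly_regular (elementary_symmetrics j)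
        (monomial_span (meets (insert y Z)) :: ('x, 'k) mpoly set) UNIV"
      by (rule Suc.IH)
  qed auto
  ultimately show ?case by simp
qed simp

section \<open>The height filtration of a monomial ideal\<close>

text \<open>
  The monomials \<open>f\<close> for which every prime \<open>(x. x \<in> C)\<close> containing \<open>I : f\<close> has height at least \<open>c\<close>,
  where \<open>I\<close> is generated by \<open>S\<close>; the subquotient of index \<open>c\<close> is to have dimension \<open>n - c\<close>.
\<close>

definition height_ge :: "nat \<Rightarrow> ('x::finite \<Rightarrow>\<^sub>0 nat) set \<Rightarrow> ('x \<Rightarrow>\<^sub>0 nat) set" where
  "height_ge c S = {f. \<forall>C. card C < c \<longrightarrow>
     (\<exists>h\<in>S. \<forall>x\<in>C. Poly_Mapping.lookup h x \<le> Poly_Mapping.lookup f x)}"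

lemma upward_closed_height_ge: "upward_closed (height_ge c S)"
  unfolding upward_closed_def height_ge_def by (simp add: lookup_add) (meson trans_le_add1)

lemma height_ge_antimono: "c \<le> c' \<Longrightarrow> height_ge c' S \<subseteq> height_ge c S"
  by (auto simp: height_ge_def)

lemma height_ge_0 [simp]: "height_ge 0 S = UNIV"
  by (simp add: height_ge_def)

lemma height_ge_zero_mem: "0 \<in> S \<Longrightarrow> height_ge c S = UNIV"
  by (auto simp: height_ge_def intro!: bexI[of _ 0])

text \<open>With c = n + 1 the set of all variables is an admissible \<open>C\<close>, so the
  filtration reaches the ideal itself.\<close>

lemma height_ge_Suc_card:
  "height_ge (Suc (card (UNIV :: 'x set))) (S :: ('x::finite \<Rightarrow>\<^sub>0 nat) set) = (\<Union>h\<in>S. multiples h)"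
proof -
  have "card C < Suc (card (UNIV :: 'x set))" for C :: "'x set"
    by (simp add: card_mono less_Suc_eq_le)
  then have "f \<in> height_ge (Suc (card (UNIV :: 'x set))) S \<longleftrightarrow> f \<in> (\<Union>h\<in>S. multiples h)" for f
    unfolding height_ge_def multiples_iff mem_Collect_eq UN_iff by (meson UNIV_I)
  then show ?thesis by blast
qed

text \<open>Truncated subtraction yields h / gcd(h, u), so the images generate I : u; and (I : u) :
  f = I : uf.\<close>

lemma height_ge_colon: "height_ge c ((\<lambda>h. h - u) ` S) = {f. u + f \<in> height_ge c S}"
  by (auto simp: height_ge_def lookup_minus lookup_add le_diff_conv add.commute)

lemma height_ge_redundant:
  assumes "m \<in> S" "g \<in> multiples m" "g \<noteq> m"
  shows "height_ge c (S - {g}) = height_ge c S"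
proof (intro equalityI subsetI)
  fix f assume f: "f \<in> height_ge c S"
  show "f \<in> height_ge c (S - {g})"
    unfolding height_ge_def
  proof (intro CollectI allI impI)
    fix C :: "'a set" assume "card C < c"
    then obtain h where h: "h \<in> S" "\<forall>x\<in>C. Poly_Mapping.lookup h x \<le> Poly_Mapping.lookup f x"
      using f by (auto simp: height_ge_def)
    show "\<exists>h\<in>S - {g}. \<forall>x\<in>C. Poly_Mapping.lookup h x \<le> Poly_Mapping.lookup f x"
    proof (cases "h = g")
      case True
      then have "\<forall>x\<in>C. Poly_Mapping.lookup m x \<le> Poly_Mapping.lookup f x"
        using h assms(2) by (auto simp: multiples_iff intro: order_trans)
      then show ?thesis using assms by blast
    qed (use h in blast)
  qed
qed (auto simp: height_ge_def)

text \<open>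
  \<open>u\<close> is a shedding monomial: if a set \<open>C\<close> of variables meets all generators but not \<open>u\<close>, it meets
  \<open>m\<close> in a variable that no other generator involves to a larger power than \<open>u\<close>, and this variable
  may be exchanged for one of \<open>u\<close>.
\<close>

lemma height_ge_shedding:
  assumes m: "m \<in> S" "m \<in> multiples u"
    and u: "\<And>h x. h \<in> S \<Longrightarrow> h \<noteq> m \<Longrightarrow>
      min (Poly_Mapping.lookup m x) (Poly_Mapping.lookup h x) \<le> Poly_Mapping.lookup u x"
  shows "height_ge c (insert u S) = height_ge c S \<union> multiples u"
proof (intro equalityI subsetI)
  fix f assume f: "f \<in> height_ge c (insert u S)"
  show "f \<in> height_ge c S \<union> multiples u"
  proof (rule ccontr)
    assume "f \<notin> height_ge c S \<union> multiples u"
    then obtain C y where C: "card C < c"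
      and meet: "\<And>h. h \<in> S \<Longrightarrow> \<exists>x\<in>C. Poly_Mapping.lookup f x < Poly_Mapping.lookup h x"
      and y: "Poly_Mapping.lookup f y < Poly_Mapping.lookup u y"
      by (force simp: height_ge_def multiples_iff not_le)
    obtain h where "h \<in> insert u S" "\<forall>x\<in>C. Poly_Mapping.lookup h x \<le> Poly_Mapping.lookup f x"
      using f C by (auto simp: height_ge_def)
    then have uC: "\<forall>x\<in>C. Poly_Mapping.lookup u x \<le> Poly_Mapping.lookup f x"
      using meet by (metis insertE not_le)
    obtain x where x: "x \<in> C" "Poly_Mapping.lookup f x < Poly_Mapping.lookup m x"
      using meet m(1) by blast
    let ?C = "insert y (C - {x})"
    have "card ?C < c"
      using C x(1) card_Suc_Diff1[of C x] card_insert_le_m1[of "card C" "C - {x}" y]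
      by (metis card_gt_0_iff empty_iff finite card_Diff_singleton le_less_trans le_refl)
    then obtain h where h: "h \<in> insert u S"
      "\<forall>z\<in>?C. Poly_Mapping.lookup h z \<le> Poly_Mapping.lookup f z"
      using f unfolding height_ge_def by blast
    have "Poly_Mapping.lookup u y \<le> Poly_Mapping.lookup m y"
      using m(2) by (simp add: multiples_iff)
    then have "h \<noteq> u" "h \<noteq> m" using h(2) y by auto
    then have "h \<in> S" using h(1) by simp
    then obtain z where z: "z \<in> C" "Poly_Mapping.lookup f z < Poly_Mapping.lookup h z"
      using meet by blast
    \<comment> \<open>On \<open>C\<close> without \<open>x\<close>, \<open>h\<close> does not exceed
      \<open>f\<close>. At \<open>x\<close> both \<open>m\<close> and \<open>h\<close> exceed
      \<open>f\<close>, hence also \<open>u\<close>, against the bound on the gcd.\<close>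
    then have "z = x" using h(2) not_le by blast
    then show False
      using u[OF \<open>h \<in> S\<close> \<open>h \<noteq> m\<close>, of x] uC x z by fastforce
  qed
next
  fix f assume "f \<in> height_ge c S \<union> multiples u"
  then show "f \<in> height_ge c (insert u S)" by (fastforce simp: height_ge_def multiples_iff)
qed

text \<open>The names come from simplicial complexes: adding \<open>u\<close> is deletion, the colon
  by \<open>u\<close> is the link. By \<open>shed\<close>, the right-hand term of the exact sequence
  is the filtration quotient of I + (u). By the modular law the kernel is I_{c+1} + u(I_c : u)
  modulo I_{c+1}, to which the colon lemma applies.\<close>

lemma weakly_regular_height_shedding:
  fixes S :: "('x::finite \<Rightarrow>\<^sub>0 nat) set" and ts :: "('x, 'k::comm_ring_1) mpoly list"
  assumes shed: "\<And>c. height_ge c (insert u S) = height_ge c S \<union> multiples u"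
    and del: "weakly_regular ts (monomial_span (height_ge (Suc c) (insert u S)))
                (monomial_span (height_ge c (insert u S)))"
    and link: "weakly_regular ts (monomial_span (height_ge (Suc c) ((\<lambda>h. h - u) ` S)))
                (monomial_span (height_ge c ((\<lambda>h. h - u) ` S)))"
  shows "weakly_regular ts (monomial_span (height_ge (Suc c) S)) (monomial_span (height_ge c S))"
proof -
  let ?D = "\<lambda>c. height_ge c S" and ?u = "Poly_Mapping.single u (1::'k)"
  let ?A = "monomial_span (?D (Suc c)) :: ('x, 'k) mpoly set"
  let ?B = "monomial_span (?D (Suc c) \<union> multiples u) :: ('x, 'k) mpoly set"
  let ?K = "monomial_span (?D c) :: ('x, 'k) mpoly set"
  let ?K' = "monomial_span (?D c \<union> multiples u) :: ('x, 'k) mpoly set"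
  have I: "ideal_set ?A" "ideal_set ?B" "ideal_set ?K"
    and J: "ideal_set (monomial_span {f. u + f \<in> ?D c} :: ('x, 'k) mpoly set)"
    by (intro ideal_set_monomial_span upward_closed_Un upward_closed_height_ge
        upward_closed_multiples upward_closed_shift)+
  have DD: "?D (Suc c) \<subseteq> ?D c" by (simp add: height_ge_antimono)
  have "weakly_regular ts ?B ?K'" using del by (simp add: shed)
  moreover have "?K \<subseteq> ?K'" by (intro monomial_span_mono) auto
  moreover have "?K' \<subseteq> ?B + ?K"
    unfolding monomial_span_plus by (intro monomial_span_mono) auto
  ultimately have BK: "weakly_regular ts ?B ?K"
    using weakly_regular_absorb[OF I(2,3)] by blast
  have "weakly_regular ts ?A (?u *o monomial_span {f. u + f \<in> ?D c})"
    using link by (intro weakly_regular_colon I J) (simp add: monomial_span_colon height_ge_colon)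
  moreover have "?u *o monomial_span {f. u + f \<in> ?D c} \<subseteq> ?B \<inter> ?K"
    unfolding elt_times_monomial_span monomial_span_inter by (intro monomial_span_mono) auto
  moreover have "?B \<inter> ?K \<subseteq> ?A + ?u *o monomial_span {f. u + f \<in> ?D c}"
    unfolding elt_times_monomial_span monomial_span_inter monomial_span_plus
    by (intro monomial_span_mono) auto
  ultimately have "weakly_regular ts ?A (?B \<inter> ?K)"
    using weakly_regular_absorb[OF I(1) ideal_set_elt_times[OF J]] by blast
  moreover have "?A \<subseteq> ?B" by (intro monomial_span_mono) auto
  ultimately show ?thesis using BK weakly_regular_ext[OF I] by blast
qed

text \<open>For an ideal generated by variables, the colon by a monomial is the ideal itself or the
  unit ideal. Hence the only jump of the filtration is at c = \<open>card Z\<close>.\<close>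

lemma height_ge_variables:
  fixes Z :: "'x::finite set"
  shows "height_ge c ((\<lambda>x. Poly_Mapping.single x 1) ` Z) = (if c \<le> card Z then UNIV else meets Z)"
proof (cases "c \<le> card Z")
  case True
  have "\<exists>x\<in>Z. x \<notin> C" if "card C < c" for C
    using card_mono[of C Z] that True by fastforce
  then show ?thesis using True by (auto simp: height_ge_def lookup_single when_def)
next
  case False
  have "f \<in> height_ge c ((\<lambda>x. Poly_Mapping.single x 1) ` Z) \<longleftrightarrow> f \<in> meets Z" for f
  proof
    assume "f \<in> height_ge c ((\<lambda>x. Poly_Mapping.single x 1) ` Z)"
    then obtain x where "x \<in> Z"
      "\<forall>y\<in>Z. Poly_Mapping.lookup (Poly_Mapping.single x (1::nat)) y \<le> Poly_Mapping.lookup f y"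
      using False not_le unfolding height_ge_def by blast
    then have "1 \<le> Poly_Mapping.lookup f x" by fastforce
    then show "f \<in> meets Z" using \<open>x \<in> Z\<close> by (auto simp: meets_def Suc_le_eq)
  next
    assume "f \<in> meets Z"
    then obtain x where x: "x \<in> Z" "0 < Poly_Mapping.lookup f x" by (auto simp: meets_def)
    then have "Poly_Mapping.lookup (Poly_Mapping.single x (1::nat)) y \<le> Poly_Mapping.lookup f y" for y
      by (auto simp: lookup_single when_def)
    then show "f \<in> height_ge c ((\<lambda>x. Poly_Mapping.single x 1) ` Z)"
      using x(1) by (auto simp: height_ge_def)
  qed
  then show ?thesis using False by auto
qed

section \<open>Forests of monomials\<close>

text \<open>Generators are allowed to divide one another, since passing to I : u or replacing a
  generator by \<open>u\<close> can create such pairs.\<close>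

definition forest_type :: "('x \<Rightarrow>\<^sub>0 nat) set \<Rightarrow> bool" where
  "forest_type S \<longleftrightarrow> (\<forall>T\<subseteq>S. T \<noteq> {} \<longrightarrow>
     (\<exists>m\<in>T. T = {m} \<or> (\<exists>g\<in>T. g \<noteq> m \<and> (\<forall>h\<in>T. h \<noteq> m \<longrightarrow>
        (\<forall>x. min (Poly_Mapping.lookup m x) (Poly_Mapping.lookup h x) \<le> Poly_Mapping.lookup g x)))))"

lemma forest_type_subset: "forest_type S \<Longrightarrow> T \<subseteq> S \<Longrightarrow> forest_type T"
  unfolding forest_type_def by (meson order_trans)

text \<open>Monotone changes of the separate exponents commute with \<open>min\<close>, so they
  carry leaves and joints along. Both operations of the induction are of this kind: truncated
  subtraction for I : u, capping of exponents for I + (u).\<close>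

lemma forest_type_image:
  assumes S: "forest_type S"
    and \<phi>: "\<And>f x. Poly_Mapping.lookup (\<phi> f) x = \<psi> x (Poly_Mapping.lookup f x)"
    and mono: "\<And>x. mono (\<psi> x)"
  shows "forest_type (\<phi> ` S)"
  unfolding forest_type_def
proof (intro allI impI)
  fix T assume "T \<subseteq> \<phi> ` S" "T \<noteq> {}"
  \<comment> \<open>The map may identify generators; choosing \<open>U\<close> with
    \<open>\<phi>\<close> injective on it keeps the joint different from the leaf.\<close>
  then obtain U where U: "U \<subseteq> S" "inj_on \<phi> U" "T = \<phi> ` U" by (auto simp: subset_image_inj)
  then have "U \<noteq> {}" using \<open>T \<noteq> {}\<close> by auto
  then obtain m where m: "m \<in> U" and alt: "U = {m} \<or> (\<exists>g\<in>U. g \<noteq> m \<and> (\<forall>h\<in>U. h \<noteq> m \<longrightarrow>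
      (\<forall>x. min (Poly_Mapping.lookup m x) (Poly_Mapping.lookup h x) \<le> Poly_Mapping.lookup g x)))"
    using S U(1) unfolding forest_type_def by meson
  from alt show "\<exists>m\<in>T. T = {m} \<or> (\<exists>g\<in>T. g \<noteq> m \<and> (\<forall>h\<in>T. h \<noteq> m \<longrightarrow>
      (\<forall>x. min (Poly_Mapping.lookup m x) (Poly_Mapping.lookup h x) \<le> Poly_Mapping.lookup g x)))"
  proof
    assume "\<exists>g\<in>U. g \<noteq> m \<and> (\<forall>h\<in>U. h \<noteq> m \<longrightarrow>
      (\<forall>x. min (Poly_Mapping.lookup m x) (Poly_Mapping.lookup h x) \<le> Poly_Mapping.lookup g x))"
    then obtain g where g: "g \<in> U" "g \<noteq> m" and le: "\<And>h x. h \<in> U \<Longrightarrow> h \<noteq> m \<Longrightarrow>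
      min (Poly_Mapping.lookup m x) (Poly_Mapping.lookup h x) \<le> Poly_Mapping.lookup g x"
      by blast
    have "min (Poly_Mapping.lookup (\<phi> m) x) (Poly_Mapping.lookup (\<phi> h) x)
        \<le> Poly_Mapping.lookup (\<phi> g) x" if "h \<in> U" "\<phi> h \<noteq> \<phi> m" for h x
      using monoD[OF mono le[of h x], of x] that by (auto simp: \<phi> min_of_mono[OF mono])
    moreover have "\<phi> g \<noteq> \<phi> m" using g m U(2) by (auto simp: inj_on_def)
    ultimately show ?thesis using g m U(3) by blast
  qed (use m U(3) in auto)
qed

section \<open>Degrees, shedding monomials and the induction\<close>

definition total_degree :: "('x::finite \<Rightarrow>\<^sub>0 nat) \<Rightarrow> nat" where
  "total_degree m = (\<Sum>x\<in>UNIV. Poly_Mapping.lookup m x)"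

lemma total_degree_eq_0_iff: "total_degree m = 0 \<longleftrightarrow> m = 0"
  by (auto simp: total_degree_def intro: poly_mapping_eqI)

lemma total_degree_single: "total_degree (Poly_Mapping.single x n) = n"
  by (simp add: total_degree_def lookup_single when_def)

lemma total_degree_strict_mono:
  assumes "m \<in> multiples u" "u \<noteq> m"
  shows "total_degree u < total_degree m"
proof -
  obtain x where "Poly_Mapping.lookup u x \<noteq> Poly_Mapping.lookup m x"
    using assms(2) by (meson poly_mapping_eqI)
  then show ?thesis
    using assms(1) unfolding total_degree_def multiples_iff
    by (intro sum_strict_mono_ex1) (auto simp: le_less)
qed

lemma total_degree_minus_less:
  assumes "m \<in> multiples u" "u \<noteq> 0"
  shows "total_degree (m - u) < total_degree m"
proof -
  obtain x where "Poly_Mapping.lookup u x \<noteq> 0"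
    using assms(2) by (metis poly_mapping_eqI lookup_zero)
  moreover have "Poly_Mapping.lookup u x \<le> Poly_Mapping.lookup m x"
    using assms(1) by (simp add: multiples_iff)
  ultimately have "Poly_Mapping.lookup (m - u) x < Poly_Mapping.lookup m x"
    by (simp add: lookup_minus)
  then show ?thesis
    unfolding total_degree_def
    by (intro sum_strict_mono_ex1) (auto simp: lookup_minus simp del: diff_less)
qed

lemma total_degree_eq_1E:
  assumes "total_degree m = 1"
  obtains x where "m = Poly_Mapping.single x 1"
proof -
  obtain x where x: "Poly_Mapping.lookup m x \<noteq> 0"
    using assms by (metis poly_mapping_eqI lookup_zero total_degree_eq_0_iff zero_neq_one)
  then have "m \<in> multiples (Poly_Mapping.single x 1)"
    by (auto simp: multiples_iff lookup_single when_def Suc_le_eq)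
  then have "m = Poly_Mapping.single x 1"
    using total_degree_strict_mono[of m "Poly_Mapping.single x 1"] assms
    by (metis less_irrefl total_degree_single)
  then show thesis by (rule that)
qed

text \<open>
  The shedding monomial is \<open>gcd(m, g)\<close> for a leaf \<open>m\<close> with joint \<open>g\<close>, or a variable of \<open>m\<close> if \<open>m\<close> is
  coprime to all other generators.
\<close>

lemma forest_type_shedding_monomial:
  fixes S :: "('x::finite \<Rightarrow>\<^sub>0 nat) set"
  assumes S: "forest_type S" and zero: "0 \<notin> S"
    and anti: "\<forall>m\<in>S. \<forall>g\<in>S. g \<in> multiples m \<longrightarrow> g = m"
    and big: "h0 \<in> S" "total_degree h0 \<noteq> 1"
  obtains m u where "m \<in> S" "m \<in> multiples u" "u \<noteq> m" "u \<noteq> 0"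
    "\<And>h x. h \<in> S \<Longrightarrow> h \<noteq> m \<Longrightarrow>
      min (Poly_Mapping.lookup m x) (Poly_Mapping.lookup h x) \<le> Poly_Mapping.lookup u x"
proof -
  note found = that
  \<comment> \<open>Variables among the generators are set aside, so that the leaf has degree at
    least 2 and each of its variables is a proper divisor. They are coprime to the leaf because no
    generator divides another.\<close>
  define T where "T = {h\<in>S. total_degree h \<noteq> 1}"
  have "T \<subseteq> S" "T \<noteq> {}" using big by (auto simp: T_def)
  then obtain m where m: "m \<in> T" and alt: "T = {m} \<or> (\<exists>g\<in>T. g \<noteq> m \<and> (\<forall>h\<in>T. h \<noteq> m \<longrightarrow>
      (\<forall>x. min (Poly_Mapping.lookup m x) (Poly_Mapping.lookup h x) \<le> Poly_Mapping.lookup g x)))"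
    using S unfolding forest_type_def by meson
  have mS: "m \<in> S" "total_degree m \<noteq> 1" "m \<noteq> 0" using m zero by (auto simp: T_def)
  have var: "min (Poly_Mapping.lookup m x) (Poly_Mapping.lookup h x) = 0"
    if "h \<in> S" "h \<notin> T" for h x
  proof -
    from that have "total_degree h = 1" by (simp add: T_def)
    then obtain y where y: "h = Poly_Mapping.single y 1" by (rule total_degree_eq_1E)
    have "m \<notin> multiples h" using anti that mS(1) m by auto
    then have "Poly_Mapping.lookup m y = 0"
      by (auto simp: y multiples_iff lookup_single when_def split: if_splits)
    then show ?thesis by (auto simp: y lookup_single when_def)
  qed
  have coprime: thesis if cop: "\<And>h x. h \<in> S \<Longrightarrow> h \<noteq> m \<Longrightarrow>
      min (Poly_Mapping.lookup m x) (Poly_Mapping.lookup h x) = 0"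
  proof -
    obtain y where y: "Poly_Mapping.lookup m y \<noteq> 0"
      using mS(3) by (metis poly_mapping_eqI lookup_zero)
    show thesis
    proof (rule found)
      show "m \<in> multiples (Poly_Mapping.single y 1)"
        using y by (auto simp: multiples_iff lookup_single when_def Suc_le_eq)
      show "Poly_Mapping.single y 1 \<noteq> m" using mS(2) total_degree_single[of y 1] by auto
      show "Poly_Mapping.single y (1::nat) \<noteq> 0"
        by (metis total_degree_single total_degree_eq_0_iff zero_neq_one)
    qed (use mS(1) cop in simp_all)
  qed
  from alt show thesis
  proof
    assume "T = {m}"
    then show thesis using var by (intro coprime) auto
  next
    assume "\<exists>g\<in>T. g \<noteq> m \<and> (\<forall>h\<in>T. h \<noteq> m \<longrightarrow>
      (\<forall>x. min (Poly_Mapping.lookup m x) (Poly_Mapping.lookup h x) \<le> Poly_Mapping.lookup g x))"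
    then obtain g where g: "g \<in> T" "g \<noteq> m" and le: "\<And>h x. h \<in> T \<Longrightarrow> h \<noteq> m \<Longrightarrow>
      min (Poly_Mapping.lookup m x) (Poly_Mapping.lookup h x) \<le> Poly_Mapping.lookup g x"
      by blast
    \<comment> \<open>Subtracting twice with truncation leaves the minimum of the exponents, that is
      the gcd.\<close>
    define u where "u = m - (m - g)"
    have u: "Poly_Mapping.lookup u x = min (Poly_Mapping.lookup m x) (Poly_Mapping.lookup g x)" for x
      by (simp add: u_def lookup_minus)
    have leu: "min (Poly_Mapping.lookup m x) (Poly_Mapping.lookup h x) \<le> Poly_Mapping.lookup u x"
      if "h \<in> S" "h \<noteq> m" for h x
      using le[of h x] var[of h x] that by (cases "h \<in> T") (auto simp: u)
    show thesis
    proof (cases "u = 0")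
      case True
      then show thesis using leu by (intro coprime) fastforce
    next
      case False
      have "g \<notin> multiples m" using anti g mS(1) by (auto simp: T_def)
      then have "u \<noteq> m" by (auto simp: multiples_iff u min_def poly_mapping_eq_iff fun_eq_iff)
      moreover have "m \<in> multiples u" by (simp add: multiples_iff u)
      ultimately show thesis using False mS(1) leu that by blast
    qed
  qed
qed

text \<open>The new set is the image of \<open>S\<close> under capping: in each variable where
  \<open>u\<close> is strictly below \<open>m\<close>, exponents are cut down to that of
  \<open>u\<close>. This turns \<open>m\<close> into \<open>u\<close> and fixes all other
  generators, which do not exceed \<open>u\<close> in these variables.\<close>

lemma forest_type_replace:
  fixes S :: "('x::finite \<Rightarrow>\<^sub>0 nat) set"
  assumes S: "forest_type S" and m: "m \<in> S" "m \<in> multiples u"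
    and u: "\<And>h x. h \<in> S \<Longrightarrow> h \<noteq> m \<Longrightarrow>
      min (Poly_Mapping.lookup m x) (Poly_Mapping.lookup h x) \<le> Poly_Mapping.lookup u x"
  shows "forest_type (insert u (S - {m}))"
proof -
  define \<psi> where "\<psi> x n =
    (if Poly_Mapping.lookup u x < Poly_Mapping.lookup m x then min n (Poly_Mapping.lookup u x) else n)" for x n
  define \<phi> :: "('x \<Rightarrow>\<^sub>0 nat) \<Rightarrow> 'x \<Rightarrow>\<^sub>0 nat"
    where "\<phi> f = Abs_poly_mapping (\<lambda>x. \<psi> x (Poly_Mapping.lookup f x))" for f
  have \<phi>: "Poly_Mapping.lookup (\<phi> f) x = \<psi> x (Poly_Mapping.lookup f x)" for f x
    by (simp add: \<phi>_def)
  have "forest_type (\<phi> ` S)"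
    by (rule forest_type_image[OF S, of \<phi> \<psi>]) (auto simp: \<phi> mono_def \<psi>_def)
  moreover have "\<phi> h = h" if "h \<in> S" "h \<noteq> m" for h
  proof (rule poly_mapping_eqI)
    show "Poly_Mapping.lookup (\<phi> h) x = Poly_Mapping.lookup h x" for x
      using u[OF that, of x] by (auto simp: \<phi> \<psi>_def min_def split: if_splits)
  qed
  moreover have "\<phi> m = u"
  proof (rule poly_mapping_eqI)
    show "Poly_Mapping.lookup (\<phi> m) x = Poly_Mapping.lookup u x" for x
      using m(2) by (auto simp: \<phi> \<psi>_def multiples_iff le_less)
  qed
  ultimately have "forest_type (\<phi> ` S)" "\<phi> ` (S - {m}) = S - {m}" "\<phi> m = u" by auto
  moreover have "\<phi> ` S = insert (\<phi> m) (\<phi> ` (S - {m}))" using m(1) by blast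
  ultimately show ?thesis by simp
qed

text \<open>The index \<open>c\<close>, and with it the sequence, stays fixed while the sum of the
  degrees of the generators drops. Constants and redundant generators are disposed of first, so that
  a shedding monomial is available unless all generators are variables.\<close>

theorem weakly_regular_height_filtration:
  fixes S :: "('x::finite \<Rightarrow>\<^sub>0 nat) set"
  assumes "finite S" "forest_type S" "j + c = card (UNIV :: 'x set)"
  shows "weakly_regular (elementary_symmetrics j :: ('x, 'k::comm_ring_1) mpoly list)
           (monomial_span (height_ge (Suc c) S)) (monomial_span (height_ge c S))"
  using assms(1,2)
proof (induction "\<Sum>m\<in>S. total_degree m" arbitrary: S rule: less_induct)
  case (less S)
  note fin = \<open>finite S\<close> and S = \<open>forest_type S\<close>
  \<comment> \<open>Where the filtration does not jump, the module is zero.\<close>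
  have trivial: ?case if "height_ge (Suc c) S = height_ge c S"
    unfolding that
    by (intro weakly_regular_trivial ideal_set_monomial_span upward_closed_height_ge) simp
  consider (unit) "0 \<in> S"
    | (redundant) m g where "0 \<notin> S" "m \<in> S" "g \<in> S" "g \<in> multiples m" "g \<noteq> m"
    | (vars) "\<And>h. h \<in> S \<Longrightarrow> total_degree h = 1"
    | (shed) h where "0 \<notin> S" "\<forall>m\<in>S. \<forall>g\<in>S. g \<in> multiples m \<longrightarrow> g = m"
        "h \<in> S" "total_degree h \<noteq> 1"
    by blast
  then show ?case
  proof cases
    case unit
    then show ?thesis by (intro trivial) (simp add: height_ge_zero_mem)
  next
    case redundant
    then have "(\<Sum>m\<in>S - {g}. total_degree m) < (\<Sum>m\<in>S. total_degree m)"
      using fin total_degree_eq_0_iff[of g] by (auto simp: sum.remove[of S g])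
    then have "weakly_regular (elementary_symmetrics j :: ('x, 'k) mpoly list)
        (monomial_span (height_ge (Suc c) (S - {g}))) (monomial_span (height_ge c (S - {g})))"
      using fin S by (intro less.hyps) (auto intro: forest_type_subset)
    then show ?thesis using redundant by (simp add: height_ge_redundant)
  next
    case vars
    define Z where "Z = {x. Poly_Mapping.single x 1 \<in> S}"
    have "h \<in> (\<lambda>x. Poly_Mapping.single x 1) ` Z" if h: "h \<in> S" for h
    proof -
      obtain x where "h = Poly_Mapping.single x 1"
        by (rule total_degree_eq_1E[OF vars[OF h]])
      then show ?thesis using h by (auto simp: Z_def)
    qed
    then have SZ: "S = (\<lambda>x. Poly_Mapping.single x 1) ` Z" by (auto simp: Z_def)
    have cards: "card (- Z) + card Z = card (UNIV :: 'x set)"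
      by (metis Compl_partition2 Int_commute card_Un_disjoint compl_inf_bot finite)
    show ?thesis
    proof (cases "c = card Z")
      case True
      then have "card (- Z) = j" using cards assms(3) by simp
      then show ?thesis
        using True weakly_regular_elementary_symmetrics[of Z j]
        unfolding SZ height_ge_variables by simp
    qed (intro trivial, unfold SZ height_ge_variables, simp)
  next
    case shed
    obtain m u where mu: "m \<in> S" "m \<in> multiples u" "u \<noteq> m" "u \<noteq> 0"
      and le: "\<And>h x. h \<in> S \<Longrightarrow> h \<noteq> m \<Longrightarrow>
        min (Poly_Mapping.lookup m x) (Poly_Mapping.lookup h x) \<le> Poly_Mapping.lookup u x"
      using forest_type_shedding_monomial[OF S shed] by blast
    \<comment> \<open>In I + (u) the generator \<open>m\<close> is redundant, so \<open>?S1\<close>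
      has the proper divisor \<open>u\<close> in its place; \<open>?S2\<close> generates I :
      u.\<close>
    let ?S1 = "insert u (S - {m})" and ?S2 = "(\<lambda>h. h - u) ` S"
    show ?thesis
    proof (rule weakly_regular_height_shedding)
      show "height_ge c (insert u S) = height_ge c S \<union> multiples u" for c
        using mu le by (intro height_ge_shedding) auto
      have "(\<Sum>m\<in>?S1. total_degree m) \<le> total_degree u + (\<Sum>m\<in>S - {m}. total_degree m)"
        using fin by (simp add: sum.insert_if)
      also have "\<dots> < (\<Sum>m\<in>S. total_degree m)"
        using fin mu total_degree_strict_mono[of m u] by (simp add: sum.remove[of S m])
      finally have "weakly_regular (elementary_symmetrics j :: ('x, 'k) mpoly list)
          (monomial_span (height_ge (Suc c) ?S1)) (monomial_span (height_ge c ?S1))"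
        using fin forest_type_replace[OF S mu(1,2) le] by (intro less.hyps) auto
      moreover have "height_ge c ?S1 = height_ge c (insert u S)" for c
      proof -
        have "?S1 = insert u S - {m}" using mu(3) by blast
        then show ?thesis using height_ge_redundant[of u "insert u S" m c] mu(2,3) by simp
      qed
      ultimately show "weakly_regular (elementary_symmetrics j :: ('x, 'k) mpoly list)
          (monomial_span (height_ge (Suc c) (insert u S))) (monomial_span (height_ge c (insert u S)))"
        by simp
      have "(\<Sum>m\<in>?S2. total_degree m) \<le> (\<Sum>h\<in>S. total_degree (h - u))"
        using sum_image_le[OF fin, of total_degree "\<lambda>h. h - u"] by (simp add: o_def)
      also have "\<dots> < (\<Sum>h\<in>S. total_degree h)"
      proof (rule sum_strict_mono_ex1[OF fin])
        show "\<forall>h\<in>S. total_degree (h - u) \<le> total_degree h"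
          by (auto simp: total_degree_def lookup_minus intro!: sum_mono)
        show "\<exists>h\<in>S. total_degree (h - u) < total_degree h"
          using total_degree_minus_less mu by blast
      qed
      finally show "weakly_regular (elementary_symmetrics j :: ('x, 'k) mpoly list)
          (monomial_span (height_ge (Suc c) ?S2)) (monomial_span (height_ge c ?S2))"
        using fin forest_type_image[OF S, of "\<lambda>h. h - u" "\<lambda>x n. n - Poly_Mapping.lookup u x"]
        by (intro less.hyps) (auto simp: lookup_minus mono_def diff_le_mono)
    qed
  qed
qed

section \<open>Dimension\<close>

text \<open>Gaussian elimination: the equation \<open>b\<close> determines the unknown at the pivot
  \<open>p\<close>, and substituting it removes one unknown and one equation.\<close>

lemma homogeneous_system_nontrivial_solution:
  fixes M :: "'a \<Rightarrow> 'b \<Rightarrow> 'k::field"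
  assumes "finite B" "finite A" "card B < card A"
  shows "\<exists>c. (\<exists>a\<in>A. c a \<noteq> 0) \<and> (\<forall>b\<in>B. (\<Sum>a\<in>A. c a * M a b) = 0)"
  using assms
proof (induction B arbitrary: A M rule: finite_induct)
  case empty
  then show ?case by (intro exI[of _ "\<lambda>_. 1"]) (auto simp: card_gt_0_iff)
next
  case (insert b B)
  show ?case
  proof (cases "\<forall>a\<in>A. M a b = 0")
    case True
    then show ?thesis using insert.IH[of A M] insert by auto
  next
    case False
    then obtain p where p: "p \<in> A" "M p b \<noteq> 0" by blast
    let ?A = "A - {p}" and ?M = "\<lambda>a b'. M a b' - M a b / M p b * M p b'"
    have "card B < card ?A" using insert p by simp
    then obtain c where c: "\<exists>a\<in>?A. c a \<noteq> 0" "\<And>b'. b' \<in> B \<Longrightarrow> (\<Sum>a\<in>?A. c a * ?M a b') = 0"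
      using insert.IH[of ?A ?M] insert.prems by auto
    let ?c = "c(p := - (\<Sum>a\<in>?A. c a * M a b / M p b))"
    have sum: "(\<Sum>a\<in>A. ?c a * M a b') = (\<Sum>a\<in>?A. c a * ?M a b')" for b'
    proof -
      have "(\<Sum>a\<in>A. ?c a * M a b') = ?c p * M p b' + (\<Sum>a\<in>?A. ?c a * M a b')"
        using p insert.prems by (simp add: sum.remove)
      also have "(\<Sum>a\<in>?A. ?c a * M a b') = (\<Sum>a\<in>?A. c a * M a b')"
        by (intro sum.cong) auto
      also have "?c p * M p b' + (\<Sum>a\<in>?A. c a * M a b') = (\<Sum>a\<in>?A. c a * ?M a b')"
        by (simp add: sum_distrib_right right_diff_distrib sum_subtractf mult.assoc)
      finally show ?thesis .
    qed
    have "(\<Sum>a\<in>?A. c a * ?M a b) = 0" using p by (intro sum.neutral) auto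
    then have "\<forall>b'\<in>insert b B. (\<Sum>a\<in>A. ?c a * M a b') = 0" using c(2) sum by auto
    moreover have "\<exists>a\<in>A. ?c a \<noteq> 0" using c(1) by auto
    ultimately show ?thesis by blast
  qed
qed

section \<open>Algebraic independence along a chain of primes\<close>

definition exponents :: "nat \<Rightarrow> nat \<Rightarrow> nat list set" where
  "exponents N n = {a. set a \<subseteq> {..<N} \<and> length a = n}"

lemma exponents_Suc: "exponents N (Suc n) = (\<lambda>(i, a). i # a) ` ({..<N} \<times> exponents N n)"
  by (auto simp: exponents_def length_Suc_conv image_iff)

lemma card_exponents: "card (exponents N n) = N ^ n" and finite_exponents: "finite (exponents N n)"
  unfolding exponents_def by (simp_all add: card_lists_length_eq finite_lists_length_eq)

primrec power_product :: "'a::comm_ring_1 list \<Rightarrow> nat list \<Rightarrow> 'a" where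
  "power_product [] a = 1"
| "power_product (f # fs) a = f ^ hd a * power_product fs (tl a)"

abbreviation const :: "'k::comm_ring_1 \<Rightarrow> ('x, 'k) mpoly" where
  "const \<equiv> Poly_Mapping.single 0"

lemma lookup_const_mult:
  "Poly_Mapping.lookup (const c * p) m = c * Poly_Mapping.lookup p m"
  using lookup_single_mult[of 0 c p m] by simp

definition power_combination ::
    "nat \<Rightarrow> ('x, 'k::comm_ring_1) mpoly list \<Rightarrow> (nat list \<Rightarrow> 'k) \<Rightarrow> ('x, 'k) mpoly" where
  "power_combination N fs c = (\<Sum>a\<in>exponents N (length fs). const (c a) * power_product fs a)"

lemma power_combination_Cons:
  "power_combination N (f # fs) c = (\<Sum>i<N. f ^ i * power_combination N fs (\<lambda>a. c (i # a)))"
proof -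
  have "power_combination N (f # fs) c =
      (\<Sum>(i, a)\<in>{..<N} \<times> exponents N (length fs). const (c (i # a)) * (f ^ i * power_product fs a))"
    unfolding power_combination_def length_Cons exponents_Suc
    by (subst sum.reindex) (auto simp: inj_on_def case_prod_unfold)
  also have "\<dots> = (\<Sum>i<N. f ^ i * power_combination N fs (\<lambda>a. c (i # a)))"
    by (simp add: sum.cartesian_product[symmetric] power_combination_def sum_distrib_left
        mult.left_commute)
  finally show ?thesis .
qed

text \<open>
  Elements separating the members of a chain of primes are algebraically independent: otherwise take
  the least exponent of the first element in a relation, and divide by that power.
\<close>

lemma power_combination_prime_chain:
  fixes fs :: "('x, 'k::field) mpoly list"
  assumes "\<And>i. i \<le> length fs \<Longrightarrow> prime_ideal_set (P i)"
    and "\<And>i. i < length fs \<Longrightarrow> P i \<subseteq> P (Suc i) \<and> fs ! i \<in> P (Suc i) - P i"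
    and "power_combination N fs c \<in> P 0" "a \<in> exponents N (length fs)"
  shows "c a = 0"
  using assms
proof (induction fs arbitrary: P c a)
  case Nil
  have a: "a = []" "exponents N 0 = {[]}" using Nil.prems(4) by (auto simp: exponents_def)
  show ?case
  proof (rule ccontr)
    assume nz: "c a \<noteq> 0"
    have P0: "prime_ideal_set (P 0)" using Nil.prems(1) by simp
    have "const (inverse (c a)) * const (c a) \<in> P 0"
      using Nil.prems(3) a prime_ideal_setD(1)[OF P0]
      by (intro ideal_set_mult) (simp_all add: power_combination_def)
    then have "1 \<in> P 0" using nz by (simp add: mult_single)
    then show False using prime_ideal_setD(2)[OF P0] by simp
  qed
next
  case (Cons f fs)
  define g where "g i = power_combination N fs (\<lambda>a. c (i # a))" for i
  have P0: "prime_ideal_set (P 0)" and P1: "prime_ideal_set (P 1)"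
    using Cons.prems(1)[of 0] Cons.prems(1)[of 1] by auto
  have f: "P 0 \<subseteq> P 1" "f \<in> P 1" "f \<notin> P 0" using Cons.prems(2)[of 0] by auto
  \<comment> \<open>A coefficient of a power of \<open>f\<close> that lies in \<open>P 1\<close> is
    a relation for the remaining elements along the chain starting at \<open>P 1\<close>.\<close>
  have coeff: "c (i # a) = 0" if "g i \<in> P 1" "a \<in> exponents N (length fs)" for i a
    using Cons.prems(1)[of "Suc _"] Cons.prems(2)[of "Suc _"] that
    by (intro Cons.IH[of "\<lambda>i. P (Suc i)" "\<lambda>a. c (i # a)"]) (auto simp: g_def)
  have g: "g i \<in> P 1" if "i < N" for i
    using that
  proof (induction i rule: less_induct)
    case (less i)
    have zero: "g l = 0" if "l < i" for l
      using coeff[OF less.IH[OF that]] that less.prems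
      by (auto simp: g_def power_combination_def intro!: sum.neutral)
    have "power_combination N (f # fs) c = (\<Sum>l<N. f ^ l * g l)"
      by (simp add: power_combination_Cons g_def)
    also have "\<dots> = (\<Sum>l\<in>{i..<N}. f ^ l * g l)"
      using zero by (intro sum.mono_neutral_right) auto
    also have "\<dots> = f ^ i * g i + (\<Sum>l\<in>{Suc i..<N}. f ^ l * g l)"
      using less.prems by (simp add: sum.atLeast_Suc_lessThan)
    also have "(\<Sum>l\<in>{Suc i..<N}. f ^ l * g l) = (\<Sum>l\<in>{Suc i..<N}. f ^ i * (f * (f ^ (l - Suc i) * g l)))"
    proof (intro sum.cong refl)
      fix l assume "l \<in> {Suc i..<N}"
      then have "l = i + Suc (l - Suc i)" by simp
      then have "f ^ l = f ^ i * (f * f ^ (l - Suc i))" by (metis power_Suc power_add)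
      then show "f ^ l * g l = f ^ i * (f * (f ^ (l - Suc i) * g l))" by (simp add: mult.assoc)
    qed
    also have "f ^ i * g i + \<dots> = f ^ i * (g i + f * (\<Sum>l\<in>{Suc i..<N}. f ^ (l - Suc i) * g l))"
      by (simp add: distrib_left sum_distrib_left)
    finally have "f ^ i * (g i + f * (\<Sum>l\<in>{Suc i..<N}. f ^ (l - Suc i) * g l)) \<in> P 0"
      using Cons.prems(3) by simp
    then have "g i + f * (\<Sum>l\<in>{Suc i..<N}. f ^ (l - Suc i) * g l) \<in> P 1"
      using prime_ideal_setD(3)[OF P0] prime_ideal_set_power[OF P0] f by blast
    moreover have "f * (\<Sum>l\<in>{Suc i..<N}. f ^ (l - Suc i) * g l) \<in> P 1"
      using ideal_set_mult[OF prime_ideal_setD(1)[OF P1] f(2)] by (subst mult.commute)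
    ultimately show ?case
      using ideal_set_diff[OF prime_ideal_setD(1)[OF P1]] by fastforce
  qed
  from Cons.prems(4) obtain i a' where "a = i # a'" "i < N" "a' \<in> exponents N (length fs)"
    by (auto simp: exponents_Suc)
  then show ?case using coeff[OF g] by simp
qed

text \<open>Each exponent is bounded separately instead of the total degree, so the admissible
  monomials form a box and are counted by a plain power.\<close>

definition exponent_bound :: "('x, 'k::comm_ring_1) mpoly \<Rightarrow> nat \<Rightarrow> bool" where
  "exponent_bound p b \<longleftrightarrow> (\<forall>m\<in>Poly_Mapping.keys p. \<forall>x. Poly_Mapping.lookup m x \<le> b)"

lemma exponent_bound_mult:
  assumes "exponent_bound p a" "exponent_bound q b"
  shows "exponent_bound (p * q) (a + b)"
  using assms keys_mult[of p q] by (fastforce simp: exponent_bound_def lookup_add intro: add_mono)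

lemma exponent_bound_power: "exponent_bound p a \<Longrightarrow> exponent_bound (p ^ n) (n * a)"
proof (induction n)
  case 0
  then show ?case by (simp add: exponent_bound_def)
next
  case (Suc n)
  then show ?case using exponent_bound_mult[of p a "p ^ n" "n * a"] by simp
qed

lemma exponent_bound_mono: "exponent_bound p a \<Longrightarrow> a \<le> b \<Longrightarrow> exponent_bound p b"
  by (auto simp: exponent_bound_def intro: order_trans)

lemma exponent_bound_exists:
  fixes p :: "('x::finite, 'k::comm_ring_1) mpoly"
  shows "\<exists>b. exponent_bound p b"
proof -
  let ?b = "Max ((\<lambda>(m, x). Poly_Mapping.lookup m x) ` (Poly_Mapping.keys p \<times> UNIV))"
  have "exponent_bound p ?b"
    unfolding exponent_bound_def
  proof (intro ballI allI)
    fix m x assume m: "m \<in> Poly_Mapping.keys p"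
    have fin: "finite ((\<lambda>(m, x). Poly_Mapping.lookup m x) ` (Poly_Mapping.keys p \<times> UNIV))" by simp
    show "Poly_Mapping.lookup m x \<le> ?b"
      using m by (intro Max_ge[OF fin]) (force simp: image_iff)
  qed
  then show ?thesis by blast
qed

lemma exponent_bound_power_product:
  assumes "\<And>f. f \<in> set fs \<Longrightarrow> exponent_bound f D" "a \<in> exponents N (length fs)"
  shows "exponent_bound (power_product fs a) (length fs * (N * D))"
  using assms
proof (induction fs arbitrary: a)
  case Nil
  then show ?case by (simp add: exponent_bound_def)
next
  case (Cons f fs)
  obtain i a' where a: "a = i # a'" "i < N" "a' \<in> exponents N (length fs)"
    using Cons.prems(2) by (auto simp: exponents_Suc)
  have "exponent_bound (f ^ i) (N * D)"
    using exponent_bound_power[of f D i] Cons.prems(1) a(2)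
    by (auto intro: exponent_bound_mono mult_le_mono1)
  then have "exponent_bound (f ^ i * power_product fs a') (N * D + length fs * (N * D))"
    using Cons a(3) by (intro exponent_bound_mult) auto
  then show ?case by (simp add: a(1))
qed

lemma card_bounded_monomials:
  fixes F :: "'x::finite set" and b :: nat
  defines "B \<equiv> {m :: 'x \<Rightarrow>\<^sub>0 nat. Poly_Mapping.keys m \<subseteq> F \<and> (\<forall>x. Poly_Mapping.lookup m x \<le> b)}"
  shows "finite B" "card B \<le> Suc b ^ card F"
proof -
  let ?r = "\<lambda>m :: 'x \<Rightarrow>\<^sub>0 nat. restrict (Poly_Mapping.lookup m) F"
  have inj: "inj_on ?r B"
  proof (rule inj_onI, rule poly_mapping_eqI)
    fix m m' x assume m: "m \<in> B" "m' \<in> B" "?r m = ?r m'"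
    show "Poly_Mapping.lookup m x = Poly_Mapping.lookup m' x"
    proof (cases "x \<in> F")
      case True
      then show ?thesis using m(3) by (metis restrict_apply')
    next
      case False
      then have "x \<notin> Poly_Mapping.keys m" "x \<notin> Poly_Mapping.keys m'" using m by (auto simp: B_def)
      then show ?thesis by (simp add: in_keys_iff)
    qed
  qed
  have sub: "?r ` B \<subseteq> F \<rightarrow>\<^sub>E {..b}" by (auto simp: B_def)
  have fin: "finite (F \<rightarrow>\<^sub>E {..b})" by (intro finite_PiE) auto
  show "finite B" using finite_subset[OF sub fin] inj finite_imageD by blast
  show "card B \<le> Suc b ^ card F"
    using card_inj_on_le[OF inj sub fin] by (simp add: card_PiE)
qed

text \<open>With j = \<open>card (- Z)\<close>, a longer chain would give j + 1 elements separating
  its members. Their N^(j+1) power products, taken modulo the variables in \<open>Z\<close>, lie in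
  a space whose dimension grows only like N^j, so some nontrivial combination falls into
  \<open>P 0\<close>. This contradicts algebraic independence.\<close>

theorem prime_chain_length_le:
  fixes P :: "nat \<Rightarrow> ('x::finite, 'k::field) mpoly set"
  assumes prime: "\<And>i. i \<le> l \<Longrightarrow> prime_ideal_set (P i)"
    and chain: "\<And>i. i < l \<Longrightarrow> P i \<subset> P (Suc i)"
    and Z: "monomial_span (meets Z) \<subseteq> P 0"
  shows "l \<le> card (- Z)"
proof (rule ccontr)
  assume "\<not> l \<le> card (- Z)"
  define j where "j = card (- Z)"
  have "j < l" using \<open>\<not> l \<le> card (- Z)\<close> by (simp add: j_def)
  have "\<exists>f. f \<in> P (Suc i) - P i" if "i < l" for i using chain[OF that] by blast
  then obtain f where f: "\<And>i. i < l \<Longrightarrow> f i \<in> P (Suc i) - P i" by metis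
  define fs where "fs = map f [0..<Suc j]"
  have len: "length fs = Suc j" by (simp add: fs_def)
  have "\<exists>b. \<forall>p::('x, 'k) mpoly. exponent_bound p (b p)"
    by (intro choice allI exponent_bound_exists)
  then obtain b where b: "\<And>p::('x, 'k) mpoly. exponent_bound p (b p)" by blast
  define D where "D = Max (b ` set fs)"
  have D: "exponent_bound p D" if "p \<in> set fs" for p
    using b[of p] that by (auto simp: D_def intro!: exponent_bound_mono[of p "b p"])
  \<comment> \<open>N exceeds ((j+1)D + 1)^j. Hence N^(j+1) is larger than N^j ((j+1)D + 1)^j, which
    bounds the number (E+1)^j of monomials in the remaining variables.\<close>
  define N where "N = Suc ((Suc j * D + 1) ^ j)"
  define E where "E = length fs * (N * D)"
  define B where "B = {m :: 'x \<Rightarrow>\<^sub>0 nat. Poly_Mapping.keys m \<subseteq> - Z \<and> (\<forall>x. Poly_Mapping.lookup m x \<le> E)}"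
  define A where "A = exponents N (length fs)"
  have "N > 0" by (simp add: N_def)
  have "card B \<le> Suc E ^ j"
    using card_bounded_monomials(2)[of "- Z" E] by (simp add: B_def j_def)
  also have "\<dots> \<le> (N * (Suc j * D + 1)) ^ j"
    using \<open>N > 0\<close> by (intro power_mono) (simp_all add: E_def len algebra_simps)
  also have "\<dots> = N ^ j * (Suc j * D + 1) ^ j" by (simp only: power_mult_distrib)
  also have "\<dots> < N ^ j * N"
    using \<open>N > 0\<close> by (intro mult_strict_left_mono) (simp_all add: N_def)
  also have "\<dots> = card A" by (simp add: A_def card_exponents len)
  finally have "card B < card A" .
  moreover have finB: "finite B" unfolding B_def by (rule card_bounded_monomials)
  moreover have finA: "finite A" by (simp add: A_def finite_exponents)
  \<comment> \<open>There is one equation for each bounded monomial free of \<open>Z\<close>;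
    monomials involving \<open>Z\<close> lie in \<open>P 0\<close> anyway.\<close>
  ultimately obtain c where c: "\<exists>a\<in>A. c a \<noteq> 0"
    "\<And>m. m \<in> B \<Longrightarrow> (\<Sum>a\<in>A. c a * Poly_Mapping.lookup (power_product fs a) m) = 0"
    using homogeneous_system_nontrivial_solution[of B A "\<lambda>a. Poly_Mapping.lookup (power_product fs a)"]
    by blast
  have look: "Poly_Mapping.lookup (power_combination N fs c) m =
      (\<Sum>a\<in>A. c a * Poly_Mapping.lookup (power_product fs a) m)" for m
    by (simp add: power_combination_def A_def lookup_sum lookup_const_mult)
  have "m \<in> meets Z" if "m \<in> Poly_Mapping.keys (power_combination N fs c)" for m
  proof (rule ccontr)
    assume "m \<notin> meets Z"
    then have supp: "Poly_Mapping.keys m \<subseteq> - Z" by (auto simp: meets_def in_keys_iff)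
    have ne: "(\<Sum>a\<in>A. c a * Poly_Mapping.lookup (power_product fs a) m) \<noteq> 0"
      using that by (simp add: in_keys_iff look)
    then have "m \<notin> B" using c(2) by blast
    then obtain x where x: "E < Poly_Mapping.lookup m x" using supp by (auto simp: B_def not_le)
    have "Poly_Mapping.lookup (power_product fs a) m = 0" if "a \<in> A" for a
    proof -
      have "exponent_bound (power_product fs a) E"
        unfolding E_def using D that by (intro exponent_bound_power_product) (simp_all add: A_def)
      then show ?thesis using x by (auto simp: exponent_bound_def in_keys_iff not_le[symmetric])
    qed
    then show False using ne by simp
  qed
  then have comb: "power_combination N fs c \<in> P 0"
    using Z by (auto simp: monomial_span_def)
  have "c a = 0" if "a \<in> A" for a
  proof (rule power_combination_prime_chain[of fs P N c])
    show "prime_ideal_set (P i)" if "i \<le> length fs" for i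
      using that prime \<open>j < l\<close> by (simp add: len)
    show "P i \<subseteq> P (Suc i) \<and> fs ! i \<in> P (Suc i) - P i" if "i < length fs" for i
      using that chain[of i] f[of i] \<open>j < l\<close>
      by (auto simp: fs_def nth_append less_Suc_eq simp del: upt_Suc)
  qed (use comb that in \<open>simp_all add: A_def\<close>)
  then show False using c(1) by blast
qed

section \<open>Variables in a prime over the annihilator of I_c / I_{c+1}\<close>

lemma monomial_sum:
  fixes p :: "('x, 'k::comm_ring_1) mpoly"
  shows "p = (\<Sum>m\<in>Poly_Mapping.keys p. Poly_Mapping.single m (Poly_Mapping.lookup p m))"
  by (rule poly_mapping_eqI)
    (auto simp: lookup_sum lookup_single when_def in_keys_iff sum.delta)

lemma monomial_span_meets_subset:
  fixes Q :: "('x, 'k::comm_ring_1) mpoly set"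
  assumes Q: "ideal_set Q" and vars: "\<And>x. x \<in> Z \<Longrightarrow> Poly_Mapping.single (Poly_Mapping.single x 1) 1 \<in> Q"
  shows "monomial_span (meets Z) \<subseteq> Q"
proof
  fix p :: "('x, 'k) mpoly" assume p: "p \<in> monomial_span (meets Z)"
  have "Poly_Mapping.single m (Poly_Mapping.lookup p m) \<in> Q" if "m \<in> Poly_Mapping.keys p" for m
  proof -
    have "m \<in> meets Z" using that p by (auto simp: monomial_span_def)
    then obtain x where x: "x \<in> Z" "Poly_Mapping.lookup m x > 0" by (auto simp: meets_def)
    have "m \<in> multiples (Poly_Mapping.single x 1)"
      using x(2) by (auto simp: multiples_iff lookup_single when_def)
    then obtain m' where m': "m = Poly_Mapping.single x 1 + m'" by (auto simp: multiples_def)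
    have "Poly_Mapping.single m' (Poly_Mapping.lookup p m) *
        Poly_Mapping.single (Poly_Mapping.single x 1) 1 \<in> Q"
      by (intro ideal_set_mult Q vars x(1))
    then show ?thesis by (simp add: mult_single m' add.commute)
  qed
  then have "(\<Sum>m\<in>Poly_Mapping.keys p. Poly_Mapping.single m (Poly_Mapping.lookup p m)) \<in> Q"
    by (intro ideal_set_sum Q)
  then show "p \<in> Q" by (simp add: monomial_sum[symmetric])
qed

lemma single_power:
  "Poly_Mapping.single (Poly_Mapping.single x 1) (1::'k::comm_ring_1) ^ n =
     Poly_Mapping.single (Poly_Mapping.single x n) 1"
  by (induction n) (simp_all add: mult_single single_add[symmetric])

lemma prod_single:
  "(\<Prod>x\<in>I. Poly_Mapping.single (m x) (1::'k::comm_ring_1)) =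
     Poly_Mapping.single (\<Sum>x\<in>I. m x :: 'a::comm_monoid_add) 1"
  by (induction I rule: infinite_finite_induct) (simp_all add: mult_single)

text \<open>If fewer than c variables lay in \<open>Q\<close>, these would form an admissible set
  for I_c: each monomial f of I_c dominates some generator in them. A high power w of the product of
  the other variables then makes wf divisible by that generator, so w annihilates the quotient and
  belongs to \<open>Q\<close>. As \<open>Q\<close> is prime, it contains one of the variables
  supposed to be outside.\<close>

lemma prime_over_height_annihilator:
  fixes S :: "('x::finite \<Rightarrow>\<^sub>0 nat) set" and Q :: "('x, 'k::comm_ring_1) mpoly set"
  assumes "finite S" "prime_ideal_set Q"
    and ann: "{r. \<forall>p\<in>monomial_span (height_ge c S). r * p \<in> monomial_span (height_ge (Suc c) S)} \<subseteq> Q"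
    and "c \<le> card (UNIV :: 'x set)"
  obtains Z where "card Z = c" "monomial_span (meets Z) \<subseteq> Q"
proof -
  define Y where "Y = {x. Poly_Mapping.single (Poly_Mapping.single x 1) 1 \<notin> Q}"
  have "c \<le> card (- Y)"
  proof (rule ccontr)
    assume "\<not> c \<le> card (- Y)"
    then have less: "card (- Y) < c" by simp
    \<comment> \<open>A common upper bound for all exponents in the generators.\<close>
    define N where "N = (\<Sum>h\<in>S. total_degree h)"
    have N: "Poly_Mapping.lookup h x \<le> N" if "h \<in> S" for h x
    proof -
      have "Poly_Mapping.lookup h x \<le> total_degree h"
        unfolding total_degree_def by (rule member_le_sum) auto
      also have "\<dots> \<le> N" unfolding N_def using that assms(1) by (intro member_le_sum) auto
      finally show ?thesis .
    qed
    define w where "w = (\<Sum>x\<in>Y. Poly_Mapping.single x N)"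
    have w: "Poly_Mapping.lookup w x = (if x \<in> Y then N else 0)" for x
      by (simp add: w_def lookup_sum lookup_single when_def)
    have "w + f \<in> height_ge (Suc c) S" if f: "f \<in> height_ge c S" for f
    proof -
      obtain h where h: "h \<in> S" "\<forall>x\<in>- Y. Poly_Mapping.lookup h x \<le> Poly_Mapping.lookup f x"
        using f less by (auto simp: height_ge_def)
      have "Poly_Mapping.lookup h x \<le> Poly_Mapping.lookup (w + f) x" for x
        using N[OF h(1), of x] h(2) by (auto simp: lookup_add w)
      then show ?thesis using h(1) by (auto simp: height_ge_def)
    qed
    then have "Poly_Mapping.single w 1 \<in> Q"
      by (intro subsetD[OF ann]) (auto simp: monomial_span_def keys_single_one_mult)
    moreover have "Poly_Mapping.single w (1::'k) =
        (\<Prod>x\<in>Y. Poly_Mapping.single (Poly_Mapping.single x 1) 1 ^ N)"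
      unfolding w_def single_power prod_single ..
    ultimately obtain x where "x \<in> Y" "Poly_Mapping.single (Poly_Mapping.single x 1) (1::'k) ^ N \<in> Q"
      using prime_ideal_set_prod[OF finite assms(2)] by metis
    then show False using prime_ideal_set_power[OF assms(2)] by (auto simp: Y_def)
  qed
  then obtain Z where "Z \<subseteq> - Y" "card Z = c" by (rule obtain_subset_with_card_n)
  moreover from this have "monomial_span (meets Z) \<subseteq> Q"
    by (intro monomial_span_meets_subset prime_ideal_setD(1) assms(2)) (auto simp: Y_def)
  ultimately show thesis using that by blast
qed

section \<open>Quotients of ideals as modules\<close>

lemma ring_of_type_algebra_sel [simp]:
  "carrier ring_of_type_algebra = UNIV" "monoid.mult ring_of_type_algebra = (*)"
  "one ring_of_type_algebra = 1" "ring.zero ring_of_type_algebra = 0" "add ring_of_type_algebra = (+)"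
  by (auto simp: ring_of_type_algebra_def fun_eq_iff)

lemma ideal_iff_ideal_set:
  fixes A :: "'a::comm_ring_1 set"
  shows "ideal A ring_of_type_algebra \<longleftrightarrow> ideal_set A"
proof
  assume A: "ideal A (ring_of_type_algebra :: 'a ring)"
  show "ideal_set A"
    using additive_subgroup.zero_closed[OF ideal.axioms(1)[OF A]]
      additive_subgroup.a_closed[OF ideal.axioms(1)[OF A]] ideal.I_l_closed[OF A]
    by (intro ideal_setI) auto
next
  assume A: "ideal_set A"
  have "x \<oplus>\<^bsub>ring_of_type_algebra\<^esub> (\<ominus>\<^bsub>ring_of_type_algebra\<^esub> x) = (0 :: 'a)" for x :: 'a
    using ring.ring_simprules(16)[OF ring_from_type_algebra, of x] by simp
  then have inv: "\<ominus>\<^bsub>ring_of_type_algebra\<^esub> x = - x" for x :: 'a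
    by (simp add: eq_neg_iff_add_eq_0 add.commute)
  show "ideal A (ring_of_type_algebra :: 'a ring)"
  proof (rule idealI[OF ring_from_type_algebra])
    show "subgroup A (add_monoid (ring_of_type_algebra :: 'a ring))"
      using A inv[unfolded a_inv_def]
      by (intro subgroup.intro) (auto intro: ideal_set_intros)
    fix a x assume "a \<in> A"
    then have "x * a \<in> A" by (rule ideal_set_mult[OF A])
    then show "x \<otimes>\<^bsub>ring_of_type_algebra\<^esub> a \<in> A" "a \<otimes>\<^bsub>ring_of_type_algebra\<^esub> x \<in> A"
      by (simp_all add: mult.commute)
  qed
qed

lemma primeideal_iff_prime_ideal_set:
  fixes P :: "'a::comm_ring_1 set"
  shows "primeideal P ring_of_type_algebra \<longleftrightarrow> prime_ideal_set P"
proof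
  assume "primeideal P (ring_of_type_algebra :: 'a ring)"
  then interpret primeideal P "ring_of_type_algebra :: 'a ring" .
  have "1 \<notin> P" using I_notcarr one_imp_carrier by auto
  then show "prime_ideal_set P"
    using I_prime is_ideal by (auto simp: prime_ideal_set_def ideal_iff_ideal_set)
next
  assume P: "prime_ideal_set P"
  then show "primeideal P (ring_of_type_algebra :: 'a ring)"
    by (intro primeidealI[OF _ cring_from_type_algebra])
      (auto simp: prime_ideal_set_def ideal_iff_ideal_set)
qed

lemma coset_type_algebra: "J +>\<^bsub>ring_of_type_algebra\<^esub> x = (\<lambda>j. j + x) ` J"
  by (auto simp: a_r_coset_def')

lemma coset_type_algebra_eq_iff:
  fixes J :: "'a::comm_ring_1 set"
  assumes J: "ideal_set J"
  shows "J +>\<^bsub>ring_of_type_algebra\<^esub> x = J +>\<^bsub>ring_of_type_algebra\<^esub> y \<longleftrightarrow> x - y \<in> J"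
proof
  assume "J +>\<^bsub>ring_of_type_algebra\<^esub> x = J +>\<^bsub>ring_of_type_algebra\<^esub> y"
  moreover have "0 + x \<in> J +>\<^bsub>ring_of_type_algebra\<^esub> x"
    unfolding coset_type_algebra using ideal_set_zero[OF J] by blast
  ultimately obtain j where "x = j + y" "j \<in> J" by (auto simp: coset_type_algebra)
  then show "x - y \<in> J" by simp
next
  have sub: "(\<lambda>j. j + x) ` J \<subseteq> (\<lambda>j. j + y) ` J" if "x - y \<in> J" for x y
  proof
    fix z assume "z \<in> (\<lambda>j. j + x) ` J"
    then obtain j where "z = j + x" "j \<in> J" by blast
    then have "z = (j + (x - y)) + y" "j + (x - y) \<in> J"
      using that by (auto intro: ideal_set_add[OF J])
    then show "z \<in> (\<lambda>j. j + y) ` J" by blast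
  qed
  assume "x - y \<in> J"
  then show "J +>\<^bsub>ring_of_type_algebra\<^esub> x = J +>\<^bsub>ring_of_type_algebra\<^esub> y"
    using sub[of x y] sub[of y x] ideal_set_uminus[OF J, of "x - y"]
    by (auto simp: coset_type_algebra)
qed

text \<open>The correspondence theorem: images and preimages under the coset map preserve primality
  and strict inclusion. It moves Krull dimension from the quotient to chains of primes in the ring
  itself.\<close>

lemma prime_chain_quotient_iff:
  fixes J :: "'a::comm_ring_1 set"
  assumes J: "ideal_set J"
  shows "(\<exists>P. (\<forall>i\<le>n. primeideal (P i) (ring_of_type_algebra Quot J)) \<and> (\<forall>i<n. P i \<subset> P (Suc i))) \<longleftrightarrow>
    (\<exists>P. (\<forall>i\<le>n. prime_ideal_set (P i) \<and> J \<subseteq> P i) \<and> (\<forall>i<n. P i \<subset> P (Suc i)))"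
    (is "?lhs \<longleftrightarrow> ?rhs")
proof -
  let ?R = "ring_of_type_algebra :: 'a ring"
  let ?Q = "?R Quot J"
  let ?h = "\<lambda>x. J +>\<^bsub>?R\<^esub> x"
  have J': "ideal J ?R" using J by (simp add: ideal_iff_ideal_set)
  interpret R: cring ?R by (rule cring_from_type_algebra)
  interpret hom: ring_hom_ring ?R ?Q ?h by (rule ideal.rcos_ring_hom_ring[OF J'])
  have surj: "carrier ?Q = range ?h" by (auto simp: FactRing_def A_RCOSETS_def')
  have hJ: "?h x = \<zero>\<^bsub>?Q\<^esub>" if "x \<in> J" for x
    using coset_type_algebra_eq_iff[OF J, of x 0] hom.hom_zero that by simp
  show ?thesis
  proof
    assume ?lhs
    then obtain P where P: "\<And>i. i \<le> n \<Longrightarrow> primeideal (P i) ?Q" "\<And>i. i < n \<Longrightarrow> P i \<subset> P (Suc i)"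
      by blast
    have idl: "ideal (P i) ?Q" if "i \<le> n" for i
      using P(1)[OF that] by (rule primeideal.axioms)
    have "prime_ideal_set {r. ?h r \<in> P i}" if "i \<le> n" for i
      using hom.primeideal_vimage[OF cring_from_type_algebra P(1)[OF that]]
      by (simp add: primeideal_iff_prime_ideal_set)
    moreover have "J \<subseteq> {r. ?h r \<in> P i}" if "i \<le> n" for i
      using hJ additive_subgroup.zero_closed[OF ideal.axioms(1)[OF idl[OF that]]] by auto
    moreover have "{r. ?h r \<in> P i} \<subset> {r. ?h r \<in> P (Suc i)}" if i: "i < n" for i
    proof -
      obtain z where z: "z \<in> P (Suc i)" "z \<notin> P i" using P(2)[OF i] by blast
      have "P (Suc i) \<subseteq> carrier ?Q"
        using additive_subgroup.a_subset[OF ideal.axioms(1)[OF idl[of "Suc i"]]] i by simp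
      then obtain x where "z = ?h x" using z(1) surj by auto
      then show ?thesis using z P(2)[OF i] by auto
    qed
    ultimately show ?rhs by (intro exI[of _ "\<lambda>i. {r. ?h r \<in> P i}"]) auto
  next
    assume ?rhs
    then obtain P where P: "\<And>i. i \<le> n \<Longrightarrow> prime_ideal_set (P i)" "\<And>i. i \<le> n \<Longrightarrow> J \<subseteq> P i"
      "\<And>i. i < n \<Longrightarrow> P i \<subset> P (Suc i)" by blast
    have mem: "?h x \<in> ?h ` P i \<longleftrightarrow> x \<in> P i" if "i \<le> n" for x i
    proof
      assume "?h x \<in> ?h ` P i"
      then obtain p where p: "p \<in> P i" "x - p \<in> J"
        using coset_type_algebra_eq_iff[OF J] by auto
      then have "x - p \<in> P i" using P(2)[OF that] by blast
      from ideal_set_add[OF prime_ideal_setD(1)[OF P(1)[OF that]] this p(1)] show "x \<in> P i" by simp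
    qed auto
    have "primeideal (?h ` P i) ?Q" if "i \<le> n" for i
    proof (rule primeidealI)
      show "ideal (?h ` P i) ?Q"
        using prime_ideal_setD(1)[OF P(1)[OF that]] J'
        by (intro R.ring_ideal_imp_quot_ideal) (auto simp: ideal_iff_ideal_set)
      show "cring ?Q" by (rule ideal.quotient_is_cring[OF J' cring_from_type_algebra])
      show "carrier ?Q \<noteq> ?h ` P i"
        using mem[OF that, of 1] prime_ideal_setD(2)[OF P(1)[OF that]] surj by blast
      fix a b assume "a \<in> carrier ?Q" "b \<in> carrier ?Q" and ab: "a \<otimes>\<^bsub>?Q\<^esub> b \<in> ?h ` P i"
      then obtain x y where xy: "a = ?h x" "b = ?h y" using surj by auto
      then have "?h (x * y) \<in> ?h ` P i" using ab hom.hom_mult[of x y] by simp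
      then have "x * y \<in> P i" using mem[OF that] by simp
      then show "a \<in> ?h ` P i \<or> b \<in> ?h ` P i"
        using prime_ideal_setD(3)[OF P(1)[OF that]] xy by auto
    qed
    moreover have "?h ` P i \<subset> ?h ` P (Suc i)" if i: "i < n" for i
    proof -
      obtain z where z: "z \<in> P (Suc i)" "z \<notin> P i" using P(3)[OF i] by blast
      then have "?h z \<notin> ?h ` P i" using mem[of i z] i by simp
      then show ?thesis using z(1) P(3)[OF i] by blast
    qed
    ultimately show ?lhs by (intro exI[of _ "\<lambda>i. ?h ` P i"]) auto
  qed
qed

text \<open>The module \<open>M\<close> is identified with \<open>K / A\<close> by means of the surjection \<open>\<pi>\<close>.\<close>

locale ideal_quotient_module =
  fixes M :: "('a::comm_ring_1, 'b) module" (structure) and \<pi> :: "'a \<Rightarrow> 'b" and K A :: "'a set"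
  assumes K: "ideal_set K" and A: "ideal_set A" and AK: "A \<subseteq> K"
    and carrier_eq: "carrier M = \<pi> ` K"
    and eq_iff: "x \<in> K \<Longrightarrow> y \<in> K \<Longrightarrow> \<pi> x = \<pi> y \<longleftrightarrow> x - y \<in> A"
    and add_eq: "x \<in> K \<Longrightarrow> y \<in> K \<Longrightarrow> \<pi> x \<oplus> \<pi> y = \<pi> (x + y)"
    and zero_eq: "\<zero> = \<pi> 0"
    and smult_eq: "x \<in> K \<Longrightarrow> r \<odot> \<pi> x = \<pi> (r * x)"
begin

lemmas K_intros = ideal_set_intros[OF K]

lemma is_module: "module ring_of_type_algebra M"
proof (rule moduleI[OF cring_from_type_algebra])
  show "abelian_group M"
  proof (rule abelian_groupI)
    show "\<exists>y\<in>carrier M. y \<oplus> x = \<zero>" if x: "x \<in> carrier M" for x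
    proof -
      obtain a where a: "x = \<pi> a" "a \<in> K" using x by (auto simp: carrier_eq)
      then have "\<pi> (- a) \<oplus> x = \<zero>" "\<pi> (- a) \<in> carrier M"
        using K_intros(4)[OF a(2)] by (auto simp: add_eq zero_eq carrier_eq)
      then show ?thesis by blast
    qed
  qed (auto simp: carrier_eq add_eq zero_eq K_intros algebra_simps)
qed (auto simp: carrier_eq add_eq smult_eq K_intros algebra_simps)

lemma mem_image_iff:
  assumes "ideal_set N" "A \<subseteq> N" "N \<subseteq> K" "x \<in> K"
  shows "\<pi> x \<in> \<pi> ` N \<longleftrightarrow> x \<in> N"
proof
  assume "\<pi> x \<in> \<pi> ` N"
  then obtain y where y: "y \<in> N" "x - y \<in> A" using eq_iff assms by auto
  then have "x - y \<in> N" using assms(2) by blast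
  from ideal_set_add[OF assms(1) this y(1)] show "x \<in> N" by simp
qed auto

lemma submodule_image:
  assumes N: "ideal_set N" "N \<subseteq> K"
  shows "submodule (\<pi> ` N) ring_of_type_algebra M"
proof (rule module.submoduleI[OF is_module])
  interpret module "ring_of_type_algebra :: 'a ring" M by (rule is_module)
  show "\<ominus> a \<in> \<pi> ` N" if a: "a \<in> \<pi> ` N" for a
  proof -
    obtain x where x: "a = \<pi> x" "x \<in> N" using a by blast
    then have "x \<in> K" using N by blast
    then have "\<pi> (- x) \<oplus> \<pi> x = \<zero>" "\<pi> x \<in> carrier M" "\<pi> (- x) \<in> carrier M"
      using K_intros(4)[of x] by (auto simp: add_eq zero_eq carrier_eq)
    then have "\<ominus> a = \<pi> (- x)" using x(1) minus_equality by simp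
    then show ?thesis using x(2) N(1) by (auto intro: ideal_set_uminus)
  qed
qed (use N in \<open>auto simp: carrier_eq zero_eq add_eq smult_eq subset_iff intro: ideal_set_intros\<close>)

lemma ideal_set_vimage:
  assumes "submodule H ring_of_type_algebra M"
  shows "ideal_set {x \<in> K. \<pi> x \<in> H}" "A \<subseteq> {x \<in> K. \<pi> x \<in> H}"
proof -
  note H = submodule.smult_closed[OF assms] subgroup.m_closed[OF submodule.axioms(1)[OF assms]]
    subgroup.one_closed[OF submodule.axioms(1)[OF assms]]
  show "ideal_set {x \<in> K. \<pi> x \<in> H}"
  proof (rule ideal_setI)
    show "0 \<in> {x \<in> K. \<pi> x \<in> H}" using H(3) by (simp add: zero_eq K_intros)
    show "x + y \<in> {x \<in> K. \<pi> x \<in> H}" if "x \<in> {x \<in> K. \<pi> x \<in> H}" "y \<in> {x \<in> K. \<pi> x \<in> H}" for x y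
      using that H(2)[of "\<pi> x" "\<pi> y"] by (simp add: add_eq K_intros)
    show "r * x \<in> {x \<in> K. \<pi> x \<in> H}" if "x \<in> {x \<in> K. \<pi> x \<in> H}" for r x
      using that H(1)[of r "\<pi> x"] by (simp add: smult_eq K_intros)
  qed
  have "\<pi> x = \<zero>" if "x \<in> A" for x
    using that AK eq_iff[of x 0] by (auto simp: zero_eq intro: K_intros)
  then show "A \<subseteq> {x \<in> K. \<pi> x \<in> H}" using H(3) AK by auto
qed

lemma adjoin_multiples_bounds:
  "A \<subseteq> adjoin_multiples ts A K" "adjoin_multiples ts A K \<subseteq> K"
  "t \<in> set ts \<Longrightarrow> x \<in> K \<Longrightarrow> t * x \<in> adjoin_multiples ts A K"
  using adjoin_multiples_least[OF A K ideal_set_adjoin_multiples[OF A K], of ts ts]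
    adjoin_multiples_least[OF A K K, of ts] AK by (auto intro: K_intros)

text \<open>Submodules pull back to ideals between \<open>A\<close> and \<open>K\<close>, which
  turns the intersection over submodules into the least ideal over \<open>A\<close> containing the
  prescribed multiples.\<close>

lemma ideal_smult_eq:
  "ideal_smult ring_of_type_algebra M (set ts) = \<pi> ` adjoin_multiples ts A K"
proof
  let ?N = "adjoin_multiples ts A K"
  have "submodule (\<pi> ` ?N) ring_of_type_algebra M"
    by (intro submodule_image ideal_set_adjoin_multiples A K adjoin_multiples_bounds)
  moreover have "a \<odot> x \<in> \<pi> ` ?N" if "a \<in> set ts" "x \<in> carrier M" for a x
    using that adjoin_multiples_bounds(3) by (auto simp: carrier_eq smult_eq)
  ultimately show "ideal_smult ring_of_type_algebra M (set ts) \<subseteq> \<pi> ` ?N"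
    unfolding ideal_smult_def by blast
  show "\<pi> ` ?N \<subseteq> ideal_smult ring_of_type_algebra M (set ts)"
    unfolding ideal_smult_def
  proof (rule Inter_greatest)
    fix H assume "H \<in> {N. submodule N ring_of_type_algebra M \<and>
      (\<forall>a\<in>set ts. \<forall>x\<in>carrier M. a \<odot> x \<in> N)}"
    then have H: "submodule H ring_of_type_algebra M" "\<And>t x. t \<in> set ts \<Longrightarrow> x \<in> K \<Longrightarrow> t \<odot> \<pi> x \<in> H"
      by (auto simp: carrier_eq)
    have "?N \<subseteq> {x \<in> K. \<pi> x \<in> H}"
      using H(2) ideal_set_vimage[OF H(1)] adjoin_multiples_least[OF A K ideal_set_vimage(1)[OF H(1)], of ts]
      by (auto simp: smult_eq K_intros)
    then show "\<pi> ` ?N \<subseteq> H" by auto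
  qed
qed

lemma regular_sequence_iff:
  "regular_sequence ring_of_type_algebra M ts \<longleftrightarrow>
     weakly_regular ts A K \<and> \<not> K \<subseteq> adjoin_multiples ts A K"
proof -
  have mem: "\<pi> x \<in> \<pi> ` adjoin_multiples us A K \<longleftrightarrow> x \<in> adjoin_multiples us A K" if "x \<in> K" for us x
    using that by (intro mem_image_iff ideal_set_adjoin_multiples A K adjoin_multiples_bounds)
  have "\<pi> ` adjoin_multiples ts A K \<noteq> \<pi> ` K \<longleftrightarrow> \<not> K \<subseteq> adjoin_multiples ts A K"
    using mem[of _ ts] adjoin_multiples_bounds(2)[of ts] by blast
  moreover have "ts ! i \<odot> \<pi> x \<in> \<pi> ` adjoin_multiples us A K \<longleftrightarrow> ts ! i * x \<in> adjoin_multiples us A K"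
    if "x \<in> K" for us x i
    using that by (simp add: smult_eq mem K_intros)
  ultimately show ?thesis
    unfolding regular_sequence_def weakly_regular_nth ideal_smult_eq carrier_eq
    using mem by auto
qed

lemma annihilator_eq: "annihilator ring_of_type_algebra M = {r. \<forall>x\<in>K. r * x \<in> A}"
  using eq_iff[of "_ * _" 0] by (auto simp: annihilator_def carrier_eq smult_eq zero_eq K_intros)

lemma module_dim_eq:
  "module_dim ring_of_type_algebra M = (SUP n \<in> {n. \<exists>P. (\<forall>i\<le>n. prime_ideal_set (P i) \<and>
     {r. \<forall>x\<in>K. r * x \<in> A} \<subseteq> P i) \<and> (\<forall>i<n. P i \<subset> P (Suc i))}. enat n)"
  unfolding module_dim_def krull_dim_def annihilator_eq
    prime_chain_quotient_iff[OF ideal_set_quotient[OF A]] ..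

lemma depth_le_module_dim: "depth ring_of_type_algebra J M \<le> module_dim ring_of_type_algebra M"
  unfolding depth_def
proof (rule SUP_least)
  fix ts assume "ts \<in> {rs. regular_sequence ring_of_type_algebra M rs \<and> set rs \<subseteq> J}"
  then have "\<exists>P. (\<forall>i\<le>length ts. prime_ideal_set (P i) \<and> {r. \<forall>x\<in>K. r * x \<in> A} \<subseteq> P i) \<and>
             (\<forall>i<length ts. P i \<subset> P (Suc i))"
    by (intro weakly_regular_prime_chain A K) (auto simp: regular_sequence_iff)
  then show "enat (length ts) \<le> module_dim ring_of_type_algebra M"
    unfolding module_dim_eq by (intro SUP_upper) simp
qed

text \<open>The hypotheses close the circle \<open>length ts\<close> <= depth <= dimension <=
  \<open>length ts\<close>.\<close>

lemma cohen_macaulayI: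
  assumes "weakly_regular ts A K" "\<not> K \<subseteq> adjoin_multiples ts A K"
    and irr: "set ts \<subseteq> irrelevant_ideal ring_of_type_algebra Rd"
    and bound: "\<And>n P. \<forall>i\<le>n. prime_ideal_set (P i) \<Longrightarrow> \<forall>i<n. P i \<subset> P (Suc i) \<Longrightarrow>
      {r. \<forall>x\<in>K. r * x \<in> A} \<subseteq> P 0 \<Longrightarrow> n \<le> length ts"
  shows "cohen_macaulay ring_of_type_algebra Rd M"
    and "module_dim ring_of_type_algebra M = enat (length ts)"
proof -
  let ?J = "irrelevant_ideal ring_of_type_algebra Rd"
  have "regular_sequence ring_of_type_algebra M ts" using assms by (simp add: regular_sequence_iff)
  then have "enat (length ts) \<le> depth ring_of_type_algebra ?J M"
    unfolding depth_def using irr by (intro SUP_upper) simp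
  moreover have "module_dim ring_of_type_algebra M \<le> enat (length ts)"
    unfolding module_dim_eq
  proof (rule SUP_least)
    fix n assume "n \<in> {n. \<exists>P. (\<forall>i\<le>n. prime_ideal_set (P i) \<and>
      {r. \<forall>x\<in>K. r * x \<in> A} \<subseteq> P i) \<and> (\<forall>i<n. P i \<subset> P (Suc i))}"
    then obtain P where "\<forall>i\<le>n. prime_ideal_set (P i) \<and> {r. \<forall>x\<in>K. r * x \<in> A} \<subseteq> P i"
      "\<forall>i<n. P i \<subset> P (Suc i)" by blast
    then have "n \<le> length ts" by (intro bound[of n P]) auto
    then show "enat n \<le> enat (length ts)" by simp
  qed
  ultimately show dim: "module_dim ring_of_type_algebra M = enat (length ts)"
    using depth_le_module_dim[of ?J] by (meson order.antisym order.trans)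
  with \<open>enat (length ts) \<le> depth ring_of_type_algebra ?J M\<close>
  have "depth ring_of_type_algebra ?J M = module_dim ring_of_type_algebra M"
    using depth_le_module_dim[of ?J] by simp
  moreover have "carrier M \<noteq> {\<zero>}"
  proof
    assume "carrier M = {\<zero>}"
    then have "x \<in> A" if "x \<in> K" for x
      using that eq_iff[of x 0] by (auto simp: carrier_eq zero_eq K_intros)
    then show False using assms(2) adjoin_multiples_bounds(1) by blast
  qed
  ultimately show "cohen_macaulay ring_of_type_algebra Rd M" by (simp add: cohen_macaulay_def)
qed

lemma finsum_image:
  assumes "finite D" "\<And>d. d \<in> D \<Longrightarrow> g d \<in> K"
  shows "(\<Oplus>d\<in>D. \<pi> (g d)) = \<pi> (\<Sum>d\<in>D. g d)"
proof -
  interpret module "ring_of_type_algebra :: 'a ring" M by (rule is_module)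
  show ?thesis
    using assms
  proof (induction D rule: finite_induct)
    case (insert d D)
    have "(\<Sum>d\<in>D. g d) \<in> K" using insert.prems by (intro ideal_set_sum K) auto
    then show ?case
      using insert by (subst finsum_insert) (auto simp: carrier_eq add_eq)
  qed (simp add: zero_eq)
qed

lemma image_psubset:
  assumes "ideal_set N" "A \<subseteq> N" "N \<subset> N'" "N' \<subseteq> K"
  shows "\<pi> ` N \<subset> \<pi> ` N'"
  using assms mem_image_iff[of N] by blast

text \<open>The third isomorphism theorem (N'/A)/(N/A) = N'/N. Thus cosets of cosets are again
  handled by representatives in the ring.\<close>

lemma subquotient_module:
  assumes N: "ideal_set N" "A \<subseteq> N" "N \<subseteq> N'" and N': "ideal_set N'" "N' \<subseteq> K"
  defines "M' \<equiv> M\<lparr>carrier := \<pi> ` N'\<rparr>"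
  shows "ideal_quotient_module (quot_module M' (\<pi> ` N)) (\<lambda>x. (\<pi> ` N) +>\<^bsub>M'\<^esub> \<pi> x) N' N"
proof -
  define \<rho> where "\<rho> x = (\<pi> ` N) +>\<^bsub>M'\<^esub> \<pi> x" for x
  have NK: "N \<subseteq> K" using N N' by blast
  have \<rho>: "\<rho> x = (\<lambda>n. \<pi> (n + x)) ` N" if "x \<in> N'" for x
    using that NK N'(2) by (auto simp: \<rho>_def M'_def a_r_coset_def' add_eq subset_iff image_iff)
  have carr: "a_rcosets\<^bsub>M'\<^esub> (\<pi> ` N) = \<rho> ` N'"
    by (auto simp: A_RCOSETS_def' \<rho>_def M'_def)
  have shift: "\<rho> x \<subseteq> \<rho> y" if x: "x \<in> N'" and y: "y \<in> N'" and xy: "x - y \<in> N" for x y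
  proof
    fix z assume "z \<in> \<rho> x"
    then obtain n where "z = \<pi> (n + x)" "n \<in> N" using \<rho>[OF x] by auto
    then have "z = \<pi> ((n + (x - y)) + y)" "n + (x - y) \<in> N"
      using xy by (auto intro: ideal_set_add[OF N(1)])
    then show "z \<in> \<rho> y" using \<rho>[OF y] by blast
  qed
  have eq: "\<rho> x = \<rho> y \<longleftrightarrow> x - y \<in> N" if x: "x \<in> N'" and y: "y \<in> N'" for x y
  proof
    assume "\<rho> x = \<rho> y"
    moreover have "\<pi> (0 + x) \<in> \<rho> x" using \<rho>[OF x] ideal_set_zero[OF N(1)] by blast
    ultimately obtain n where n: "\<pi> x = \<pi> (n + y)" "n \<in> N" using \<rho>[OF y] by auto
    then have "x - (n + y) \<in> A"
      using x y N' NK by (subst eq_iff[symmetric]) (auto intro: K_intros)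
    then have "x - (n + y) \<in> N" using N(2) by blast
    from ideal_set_add[OF N(1) this n(2)] show "x - y \<in> N" by simp
  next
    assume "x - y \<in> N"
    then show "\<rho> x = \<rho> y"
      using shift[OF x y] shift[OF y x] ideal_set_uminus[OF N(1), of "x - y"] by auto
  qed
  have add: "set_add M' (\<rho> x) (\<rho> y) = \<rho> (x + y)" if x: "x \<in> N'" and y: "y \<in> N'" for x y
  proof (intro equalityI subsetI)
    fix z assume "z \<in> set_add M' (\<rho> x) (\<rho> y)"
    then obtain n n' where n: "n \<in> N" "n' \<in> N" "z = \<pi> (n + x) \<oplus> \<pi> (n' + y)"
      using \<rho>[OF x] \<rho>[OF y] by (auto simp: set_add_def' M'_def)
    have "n + x \<in> K" "n' + y \<in> K" using n x y NK N' by (auto intro: K_intros)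
    then have "z = \<pi> ((n + n') + (x + y))" by (simp add: n(3) add_eq algebra_simps)
    moreover have "n + n' \<in> N" using n by (intro ideal_set_add N)
    ultimately show "z \<in> \<rho> (x + y)" using \<rho>[OF ideal_set_add[OF N'(1) x y]] by blast
  next
    fix z assume "z \<in> \<rho> (x + y)"
    then obtain n where n: "n \<in> N" "z = \<pi> (n + (x + y))"
      using \<rho>[OF ideal_set_add[OF N'(1) x y]] by auto
    have "n + x \<in> K" "0 + y \<in> K" using n x y NK N' by (auto intro: K_intros)
    then have "z = \<pi> (n + x) \<oplus> \<pi> (0 + y)" by (simp add: n(2) add_eq algebra_simps)
    moreover have "\<pi> (n + x) \<in> \<rho> x" "\<pi> (0 + y) \<in> \<rho> y"
      using \<rho>[OF x] \<rho>[OF y] n(1) ideal_set_zero[OF N(1)] by blast+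
    ultimately show "z \<in> set_add M' (\<rho> x) (\<rho> y)" by (auto simp: set_add_def' M'_def)
  qed
  \<comment> \<open>All cosets in the union coincide, and the union is over a nonempty set.\<close>
  have smult: "(\<Union>z\<in>\<rho> x. (\<pi> ` N) +>\<^bsub>M'\<^esub> (r \<odot> z)) = \<rho> (r * x)" if x: "x \<in> N'" for r x
  proof -
    have "(\<pi> ` N) +>\<^bsub>M'\<^esub> (r \<odot> z) = \<rho> (r * x)" if z: "z \<in> \<rho> x" for z
    proof -
      obtain n where n: "n \<in> N" "z = \<pi> (n + x)" using z \<rho>[OF x] by auto
      have "n + x \<in> N'" using n x N N' by (auto intro: ideal_set_add)
      then have "r \<odot> z = \<pi> (r * (n + x))" "r * (n + x) \<in> N'" "r * x \<in> N'"
        using n(2) smult_eq N' x by (auto intro: ideal_set_mult)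
      moreover have "r * (n + x) - r * x \<in> N"
        using n(1) ideal_set_mult[OF N(1)] by (simp add: distrib_left)
      ultimately show ?thesis using eq[of "r * (n + x)" "r * x"] by (simp add: \<rho>_def)
    qed
    moreover have "\<rho> x \<noteq> {}" using \<rho>[OF x] ideal_set_zero[OF N(1)] by auto
    ultimately show ?thesis by auto
  qed
  have smult': "r \<odot>\<^bsub>M'\<^esub> x = r \<odot> x" for r x by (simp add: M'_def)
  have "\<pi> ` N = \<rho> 0" using \<rho>[of 0] ideal_set_zero[OF N'(1)] by simp
  then have "ideal_quotient_module (quot_module M' (\<pi> ` N)) \<rho> N' N"
    using N N' carr eq add smult
    by unfold_locales (simp_all add: quot_module_def smult')
  then show ?thesis by (simp add: \<rho>_def[abs_def])
qed

end

text \<open>The ring as a quotient by zero is the starting point: \<open>subquotient_module\<close>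
  leads from it to R / I, and a second time to the pieces of the filtration.\<close>

lemma self_module_ideal_quotient_module:
  "ideal_quotient_module (self_module ring_of_type_algebra) (\<lambda>x. x) (UNIV :: 'a::comm_ring_1 set) {0}"
  by unfold_locales (auto simp: self_module_def ideal_set_def)

lemma coset_self_module: "I +>\<^bsub>self_module R\<^esub> x = I +>\<^bsub>R\<^esub> x"
  by (simp add: a_r_coset_def' self_module_def)

lemma quotient_ring_ideal_quotient_module:
  fixes I :: "'a::comm_ring_1 set"
  assumes "ideal_set I"
  shows "ideal_quotient_module (quot_module (self_module ring_of_type_algebra) I)
    (\<lambda>x. I +>\<^bsub>ring_of_type_algebra\<^esub> x) UNIV I"
proof -
  interpret ideal_quotient_module "self_module ring_of_type_algebra" "\<lambda>x. x" "UNIV :: 'a set" "{0}"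
    by (rule self_module_ideal_quotient_module)
  have "(self_module ring_of_type_algebra)\<lparr>carrier := (\<lambda>x. x) ` (UNIV :: 'a set)\<rparr> =
      self_module ring_of_type_algebra"
    by (simp add: self_module_def)
  then show ?thesis
    using subquotient_module[of I UNIV] assms ideal_set_zero[OF assms]
    by (simp add: coset_self_module)
qed

section \<open>Monomial ideals with a forest of generators are sequentially Cohen--Macaulay\<close>

lemma monomial_ideal_eq:
  "monomial_ideal Ms = (monomial_span (\<Union>m\<in>Ms. multiples m) :: ('x, 'k::comm_ring_1) mpoly set)"
proof
  let ?U = "\<Union>m\<in>Ms. multiples m :: ('x \<Rightarrow>\<^sub>0 nat) set"
  have "upward_closed ?U" using upward_closed_multiples by (auto simp: upward_closed_def)
  then have "ideal (monomial_span ?U :: ('x, 'k) mpoly set) mpoly_ring"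
    by (simp add: ideal_iff_ideal_set ideal_set_monomial_span)
  moreover have "(\<lambda>m. Poly_Mapping.single m 1) ` Ms \<subseteq> (monomial_span ?U :: ('x, 'k) mpoly set)"
    by (auto simp: multiples_iff)
  ultimately show "monomial_ideal Ms \<subseteq> (monomial_span ?U :: ('x, 'k) mpoly set)"
    unfolding monomial_ideal_def genideal_def by blast
  show "monomial_span ?U \<subseteq> (monomial_ideal Ms :: ('x, 'k) mpoly set)"
    unfolding monomial_ideal_def genideal_def
  proof (rule Inter_greatest, rule subsetI)
    fix J :: "('x, 'k) mpoly set" and p :: "('x, 'k) mpoly"
    assume "J \<in> {J. ideal J mpoly_ring \<and> (\<lambda>m. Poly_Mapping.single m 1) ` Ms \<subseteq> J}"
      and p: "p \<in> monomial_span ?U"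
    then have J: "ideal_set J" and gen: "\<And>m. m \<in> Ms \<Longrightarrow> Poly_Mapping.single m 1 \<in> J"
      by (auto simp: ideal_iff_ideal_set)
    have "Poly_Mapping.single f (Poly_Mapping.lookup p f) \<in> J" if f: "f \<in> Poly_Mapping.keys p" for f
    proof -
      obtain m g where "m \<in> Ms" "f = m + g"
        using f p by (fastforce simp: monomial_span_def multiples_def)
      moreover have "Poly_Mapping.single g (Poly_Mapping.lookup p f) * Poly_Mapping.single m 1 \<in> J"
        by (intro ideal_set_mult J gen) fact
      ultimately show ?thesis by (simp add: mult_single add.commute)
    qed
    then have "(\<Sum>f\<in>Poly_Mapping.keys p. Poly_Mapping.single f (Poly_Mapping.lookup p f)) \<in> J"
      by (intro ideal_set_sum J)
    then show "p \<in> J" by (simp add: monomial_sum[symmetric])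
  qed
qed

section \<open>Homogeneity, nonvanishing and strictness of the filtration\<close>

lemma mpoly_homogeneous_iff:
  fixes p :: "('x::finite, 'k::comm_ring_1) mpoly"
  shows "p \<in> mpoly_homogeneous d \<longleftrightarrow> (\<forall>m\<in>Poly_Mapping.keys p. total_degree m = d)"
proof -
  have "(\<Sum>x\<in>Poly_Mapping.keys m. Poly_Mapping.lookup m x) = total_degree m" for m :: "'x \<Rightarrow>\<^sub>0 nat"
    unfolding total_degree_def by (intro sum.mono_neutral_left) (auto simp: in_keys_iff)
  then show ?thesis by (simp add: mpoly_homogeneous_def)
qed

lemma keys_elementary_symmetric:
  "Poly_Mapping.keys (elementary_symmetric j :: ('x::finite, 'k::comm_ring_1) mpoly)
    \<subseteq> squarefree_monomial ` {T. card T = j}"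
  unfolding elementary_symmetric_def
  by (rule order_trans[OF Poly_Mapping.keys_sum]) auto

lemma total_degree_squarefree_monomial: "total_degree (squarefree_monomial T) = card T"
  by (simp add: total_degree_def lookup_squarefree_monomial sum.If_cases)

lemma elementary_symmetric_homogeneous: "elementary_symmetric j \<in> mpoly_homogeneous j"
  using keys_elementary_symmetric by (force simp: mpoly_homogeneous_iff total_degree_squarefree_monomial)

lemma elementary_symmetrics_irrelevant:
  "set (elementary_symmetrics j :: ('x::finite, 'k::comm_ring_1) mpoly list)
    \<subseteq> irrelevant_ideal mpoly_ring mpoly_homogeneous"
proof -
  let ?e = "elementary_symmetric :: nat \<Rightarrow> ('x, 'k) mpoly"
  have "?e i \<in> irrelevant_ideal mpoly_ring mpoly_homogeneous" if "i \<in> {1..j}" for i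
  proof -
    have "?e i \<in> (\<Union>d\<in>{0<..}. mpoly_homogeneous d)"
      using that elementary_symmetric_homogeneous by fastforce
    then show ?thesis unfolding irrelevant_ideal_def genideal_def by blast
  qed
  then show ?thesis by (auto simp: set_elementary_symmetrics)
qed

text \<open>Take a monomial f of least degree in U - V. Together with \<open>V\<close>, the
  monomials of \<open>U\<close> of larger degree span an ideal. It contains all products with
  \<open>ts\<close>, since these have no constant term, but it omits f.\<close>

lemma graded_nakayama:
  fixes ts :: "('x::finite, 'k::comm_ring_1) mpoly list"
  assumes U: "upward_closed U" and V: "upward_closed V" and "V \<subseteq> U" "\<not> U \<subseteq> V"
    and ts: "\<And>t. t \<in> set ts \<Longrightarrow> 0 \<notin> Poly_Mapping.keys t"
  shows "\<not> monomial_span U \<subseteq> adjoin_multiples ts (monomial_span V) (monomial_span U)"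
proof
  assume sub: "monomial_span U \<subseteq> adjoin_multiples ts (monomial_span V) (monomial_span U)"
  obtain f0 where "f0 \<in> U - V" using assms(4) by blast
  then obtain f where f: "f \<in> U - V" and least: "\<And>g. g \<in> U - V \<Longrightarrow> total_degree f \<le> total_degree g"
    using exists_least_iff[of "\<lambda>d. \<exists>g\<in>U - V. total_degree g = d"] not_le by metis
  define W where "W = V \<union> {g \<in> U. total_degree f < total_degree g}"
  have deg: "total_degree (a + b) = total_degree a + total_degree b" for a b :: "'x \<Rightarrow>\<^sub>0 nat"
    by (simp add: total_degree_def lookup_add sum.distrib)
  have W: "upward_closed W"
    using U V by (auto simp: upward_closed_def W_def deg)
  have "t * p \<in> monomial_span W" if t: "t \<in> set ts" and p: "p \<in> monomial_span U"
    for t p :: "('x, 'k) mpoly"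
  proof -
    have "a + b \<in> W" if ab: "a \<in> Poly_Mapping.keys t" "b \<in> Poly_Mapping.keys p" for a b
    proof -
      have b: "b \<in> U" using ab(2) p by (auto simp: monomial_span_def)
      have "a \<noteq> 0" using ab(1) ts[OF t] by auto
      then have "total_degree b < total_degree (a + b)"
        using total_degree_eq_0_iff[of a] by (simp add: deg)
      moreover have "b + a \<in> U" "b \<in> V \<Longrightarrow> b + a \<in> V" using b U V by (auto simp: upward_closed_def)
      ultimately show ?thesis
        using least[of b] b by (cases "b \<in> V") (auto simp: W_def add.commute)
    qed
    then show ?thesis using keys_mult[of t p] by (fastforce simp: monomial_span_def)
  qed
  moreover have "monomial_span V \<subseteq> (monomial_span W :: ('x, 'k) mpoly set)"
    by (intro monomial_span_mono) (auto simp: W_def)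
  ultimately have "adjoin_multiples ts (monomial_span V) (monomial_span U) \<subseteq> monomial_span W"
    by (subst adjoin_multiples_least) (auto intro: ideal_set_monomial_span U V W)
  moreover have "Poly_Mapping.single f 1 \<in> (monomial_span U :: ('x, 'k) mpoly set)" using f by simp
  ultimately have "Poly_Mapping.single f 1 \<in> (monomial_span W :: ('x, 'k) mpoly set)" using sub by blast
  then show False using f by (simp add: W_def)
qed

text \<open>Repetitions are dropped from the chain, while \<open>s\<close> remembers the original
  positions. These will be the dimensions of the quotients, so their growth gives the strict
  inequalities of dimensions.\<close>

lemma strict_refinement:
  assumes "\<And>i. i < N \<Longrightarrow> G i \<subseteq> G (Suc i)"
  shows "\<exists>(r::nat) F s. F 0 = G 0 \<and> F r = G N \<and>
    (\<forall>i<r. s i < N \<and> F i = G (s i) \<and> F (Suc i) = G (Suc (s i)) \<and> F i \<subset> F (Suc i)) \<and>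
    (\<forall>i. Suc i < r \<longrightarrow> s i < s (Suc i))"
  using assms
proof (induction N)
  case 0
  then show ?case by (intro exI[of _ 0] exI[of _ G]) simp
next
  case (Suc N)
  have "\<exists>(r::nat) F s. F 0 = G 0 \<and> F r = G N \<and>
    (\<forall>i<r. s i < N \<and> F i = G (s i) \<and> F (Suc i) = G (Suc (s i)) \<and> F i \<subset> F (Suc i)) \<and>
    (\<forall>i. Suc i < r \<longrightarrow> s i < s (Suc i))"
    using Suc.prems by (intro Suc.IH) simp
  then obtain r :: nat and F s where IH: "F 0 = G 0" "F r = G N"
    "\<forall>i<r. s i < N \<and> F i = G (s i) \<and> F (Suc i) = G (Suc (s i)) \<and> F i \<subset> F (Suc i)"
    "\<forall>i. Suc i < r \<longrightarrow> s i < s (Suc i)"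
    by (elim exE conjE)
  show ?case
  proof (cases "G N = G (Suc N)")
    case True
    show ?thesis
    proof (intro exI conjI)
      show "\<forall>i<r. s i < Suc N \<and> F i = G (s i) \<and> F (Suc i) = G (Suc (s i)) \<and> F i \<subset> F (Suc i)"
        using IH(3) less_SucI by blast
    qed (use IH(1,2,4) True in simp_all)
  next
    case False
    then have N: "G N \<subset> G (Suc N)" using Suc.prems by blast
    let ?F = "F(Suc r := G (Suc N))" and ?s = "s(r := N)"
    have "?s i < Suc N \<and> ?F i = G (?s i) \<and> ?F (Suc i) = G (Suc (?s i)) \<and> ?F i \<subset> ?F (Suc i)"
      if "i < Suc r" for i
    proof (cases "i = r")
      case True
      then show ?thesis using N IH(2) by simp
    next
      case False
      then have "i < r" using that by simp
      then have "?s i = s i" "?F i = F i" "?F (Suc i) = F (Suc i)" by auto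
      then show ?thesis using IH(3) \<open>i < r\<close> less_SucI by metis
    qed
    moreover have "?s i < ?s (Suc i)" if "Suc i < Suc r" for i
      using that IH(3,4) by (cases "Suc i = r") auto
    moreover have "?F 0 = G 0" "?F (Suc r) = G (Suc N)" using IH(1) by auto
    ultimately show ?thesis by blast
  qed
qed

definition homogeneous_part :: "nat \<Rightarrow> ('x::finite, 'k::comm_ring_1) mpoly \<Rightarrow> ('x, 'k) mpoly" where
  "homogeneous_part d p = Poly_Mapping.mapp (\<lambda>m v. v when total_degree m = d) p"

lemma lookup_homogeneous_part:
  "Poly_Mapping.lookup (homogeneous_part d p) m = (Poly_Mapping.lookup p m when total_degree m = d)"
  by (auto simp: homogeneous_part_def lookup_mapp when_def in_keys_iff)

lemma sum_homogeneous_parts: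
  "(\<Sum>d\<in>total_degree ` Poly_Mapping.keys p. homogeneous_part d p) = p"
  by (rule poly_mapping_eqI)
    (auto simp: lookup_sum lookup_homogeneous_part when_def in_keys_iff sum.delta)

theorem sequentially_cohen_macaulay_forest_type:
  fixes S :: "('n::finite \<Rightarrow>\<^sub>0 nat) set"
  assumes S: "finite S" "forest_type S"
  defines "I \<equiv> monomial_span (\<Union>h\<in>S. multiples h) :: ('n, 'k::field) mpoly set"
  shows "sequentially_cohen_macaulay_ideal mpoly_ring mpoly_homogeneous I"
proof -
  let ?R = "mpoly_ring :: ('n, 'k) mpoly ring"
  let ?Rd = "mpoly_homogeneous :: nat \<Rightarrow> ('n, 'k) mpoly set"
  let ?M = "quot_module (self_module ?R) I"
  let ?Md = "\<lambda>d. if d < 0 then {I} else (\<lambda>x. I +>\<^bsub>?R\<^esub> x) ` ?Rd (nat d)"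
  let ?\<pi> = "\<lambda>x. I +>\<^bsub>?R\<^esub> x"
  define n where "n = card (UNIV :: 'n set)"
  \<comment> \<open>The index is reversed so that the chain ascends from \<open>I\<close> to the
    whole ring and a nonzero quotient at step j has dimension j.\<close>
  define H where "H j = height_ge (Suc n - j) S" for j
  define G where "G j = (monomial_span (H j) :: ('n, 'k) mpoly set)" for j
  have upH: "upward_closed (H j)" for j by (simp add: H_def upward_closed_height_ge)
  have G: "ideal_set (G j)" for j unfolding G_def by (rule ideal_set_monomial_span[OF upH])
  have G0: "G 0 = I" by (simp add: G_def H_def n_def height_ge_Suc_card I_def)
  have GN: "G (Suc n) = UNIV" by (simp add: G_def H_def)
  have HS: "H j \<subseteq> H (Suc j)" for j by (simp add: H_def height_ge_antimono)
  have GS: "G j \<subseteq> G (Suc j)" for j unfolding G_def by (rule monomial_span_mono[OF HS])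
  have IG: "I \<subseteq> G j" for j using lift_Suc_mono_le[of G 0 j] GS G0 by blast
  interpret Q: ideal_quotient_module ?M ?\<pi> UNIV I
    using quotient_ring_ideal_quotient_module G[of 0] G0 by simp
  have piece: "cohen_macaulay ?R ?Rd (subquotient ?M (?\<pi> ` G (Suc j)) (?\<pi> ` G j))"
    "module_dim ?R (subquotient ?M (?\<pi> ` G (Suc j)) (?\<pi> ` G j)) = enat j"
    if j: "j \<le> n" and ne: "G j \<noteq> G (Suc j)" for j
  proof -
    let ?M' = "?M\<lparr>carrier := ?\<pi> ` G (Suc j)\<rparr>"
    let ?ts = "elementary_symmetrics j :: ('n, 'k) mpoly list"
    interpret P: ideal_quotient_module "subquotient ?M (?\<pi> ` G (Suc j)) (?\<pi> ` G j)"
        "\<lambda>x. (?\<pi> ` G j) +>\<^bsub>?M'\<^esub> ?\<pi> x" "G (Suc j)" "G j"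
      using G IG GS by (intro Q.subquotient_module) auto
    have idx: "Suc n - j = Suc (n - j)" "Suc n - Suc j = n - j" using j by auto
    have reg: "weakly_regular ?ts (G j) (G (Suc j))"
      unfolding G_def H_def idx using j S
      by (intro weakly_regular_height_filtration) (auto simp: n_def)
    have "\<not> H (Suc j) \<subseteq> H j" using ne HS[of j] unfolding G_def by (metis subset_antisym)
    moreover have "0 \<notin> Poly_Mapping.keys t" if t: "t \<in> set ?ts" for t
    proof -
      obtain i where "t = elementary_symmetric i" "i \<ge> 1"
        using t by (auto simp: set_elementary_symmetrics)
      then show ?thesis
        using elementary_symmetric_homogeneous[of i, where ?'a = 'n and ?'b = 'k]
          total_degree_eq_0_iff[of "0 :: 'n \<Rightarrow>\<^sub>0 nat"]
        by (auto simp: mpoly_homogeneous_iff)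
    qed
    ultimately have nak: "\<not> G (Suc j) \<subseteq> adjoin_multiples ?ts (G j) (G (Suc j))"
      unfolding G_def by (intro graded_nakayama upH HS)
    have bound: "l \<le> length ?ts"
      if P: "\<forall>i\<le>l. prime_ideal_set (P i)" "\<forall>i<l. P i \<subset> P (Suc i)"
        "{r. \<forall>x\<in>G (Suc j). r * x \<in> G j} \<subseteq> P 0" for l and P :: "nat \<Rightarrow> ('n, 'k) mpoly set"
    proof -
      have "prime_ideal_set (P 0)" using P(1) by simp
      moreover have "{r. \<forall>p\<in>monomial_span (height_ge (n - j) S).
          r * p \<in> monomial_span (height_ge (Suc (n - j)) S)} \<subseteq> P 0"
        using P(3) unfolding G_def H_def idx .
      \<comment> \<open>With n - j variables in its first member, the chain lives over a polynomial
        ring in j variables.\<close>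
      ultimately obtain Z :: "'n set" where Z: "card Z = n - j" "monomial_span (meets Z) \<subseteq> P 0"
        using prime_over_height_annihilator[OF S(1), of "P 0" "n - j"] by (auto simp: n_def)
      have "l \<le> card (- Z)" using P Z(2) by (intro prime_chain_length_le) auto
      also have "card (- Z) = j" using Z(1) j by (simp add: Compl_eq_Diff_UNIV card_Diff_subset n_def)
      finally show ?thesis by simp
    qed
    show "cohen_macaulay ?R ?Rd (subquotient ?M (?\<pi> ` G (Suc j)) (?\<pi> ` G j))"
      "module_dim ?R (subquotient ?M (?\<pi> ` G (Suc j)) (?\<pi> ` G j)) = enat j"
      using P.cohen_macaulayI[OF reg nak elementary_symmetrics_irrelevant] bound by auto
  qed
  have graded: "graded_submodule ?R ?M ?Md (?\<pi> ` G j)" for j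
    unfolding graded_submodule_def
  proof (intro conjI ballI)
    show "submodule (?\<pi> ` G j) ?R ?M" by (intro Q.submodule_image G) auto
    fix x assume "x \<in> ?\<pi> ` G j"
    then obtain p where p: "x = ?\<pi> p" "p \<in> G j" by blast
    \<comment> \<open>The homogeneous parts of \<open>p\<close> have their monomials among those of
      \<open>p\<close>, so they stay in the monomial ideal \<open>G j\<close>. Degrees are cast to
      integers for the grading of the module.\<close>
    let ?D = "int ` total_degree ` Poly_Mapping.keys p"
    let ?f = "\<lambda>d. ?\<pi> (homogeneous_part (nat d) p)"
    have "homogeneous_part d p \<in> G j" for d
      using p(2) by (auto simp: G_def monomial_span_def in_keys_iff lookup_homogeneous_part when_def
          split: if_splits)
    moreover have "homogeneous_part d p \<in> ?Rd d" for d
      by (auto simp: mpoly_homogeneous_iff in_keys_iff lookup_homogeneous_part when_def split: if_splits)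
    ultimately have "\<forall>d\<in>?D. ?f d \<in> ?\<pi> ` G j \<inter> ?Md d" by auto
    moreover have "x = (\<Oplus>\<^bsub>?M\<^esub>d\<in>?D. ?f d)"
    proof -
      have "(\<Sum>d\<in>?D. homogeneous_part (nat d) p) = p"
        by (subst sum.reindex) (auto simp: sum_homogeneous_parts)
      then show ?thesis by (subst Q.finsum_image) (auto simp: p(1))
    qed
    ultimately show "\<exists>D f. finite D \<and> (\<forall>d\<in>D. f d \<in> ?\<pi> ` G j \<inter> ?Md d) \<and> x = (\<Oplus>\<^bsub>?M\<^esub>d\<in>D. f d)"
      by (intro exI[of _ ?D] exI[of _ ?f]) auto
  qed
  obtain r :: nat and F s where F: "F 0 = G 0" "F r = G (Suc n)"
    and step: "\<And>i. i < r \<Longrightarrow> s i \<le> n \<and> F i = G (s i) \<and> F (Suc i) = G (Suc (s i)) \<and> F i \<subset> F (Suc i)"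
    and mono: "\<And>i. Suc i < r \<Longrightarrow> s i < s (Suc i)"
    using strict_refinement[of "Suc n" G] GS by (auto simp: less_Suc_eq_le)
  have FG: "\<exists>j. F i = G j" if "i \<le> r" for i
    using that F(2) step[of i] by (cases "i = r") auto
  have dim: "module_dim ?R (subquotient ?M (?\<pi> ` F (Suc i)) (?\<pi> ` F i)) = enat (s i)"
    and cm: "cohen_macaulay ?R ?Rd (subquotient ?M (?\<pi> ` F (Suc i)) (?\<pi> ` F i))" if "i < r" for i
    using piece[of "s i"] step[OF that] by auto
  show ?thesis
    unfolding sequentially_cohen_macaulay_ideal_def sequentially_cohen_macaulay_def
  proof (intro exI[of _ r] exI[of _ "\<lambda>i. ?\<pi> ` F i"] conjI allI impI)
    have "?\<pi> ` I \<subseteq> {?\<pi> 0}" using Q.eq_iff[of _ 0] by auto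
    then have "?\<pi> ` I = {?\<pi> 0}" using ideal_set_zero[OF Q.A] by blast
    then show "?\<pi> ` F 0 = {\<zero>\<^bsub>?M\<^esub>}" unfolding F(1) G0 Q.zero_eq .
    show "?\<pi> ` F r = carrier ?M" by (simp add: F(2) GN Q.carrier_eq)
    show "graded_submodule ?R ?M ?Md (?\<pi> ` F i)" if "i \<le> r" for i
      using graded FG[OF that] by auto
    show "?\<pi> ` F i \<subset> ?\<pi> ` F (Suc i)" if "i < r" for i
      using step[OF that] G IG by (intro Q.image_psubset) auto
    show "cohen_macaulay ?R ?Rd (subquotient ?M (?\<pi> ` F (Suc i)) (?\<pi> ` F i))" if "i < r" for i
      using cm[OF that] .
    show "module_dim ?R (subquotient ?M (?\<pi> ` F (Suc i)) (?\<pi> ` F i))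
        < module_dim ?R (subquotient ?M (?\<pi> ` F (Suc (Suc i))) (?\<pi> ` F (Suc i)))"
      if "Suc i < r" for i
      using that mono[OF that] by (simp add: dim)
  qed
qed

section \<open>Polarization\<close>

lemma lookup_polarize:
  "Poly_Mapping.lookup (polarize m) (x, j) = (if 1 \<le> j \<and> j \<le> Poly_Mapping.lookup m x then 1 else 0)"
proof -
  have "(\<Sum>i = 1..Poly_Mapping.lookup m y. Poly_Mapping.lookup (Poly_Mapping.single (y, i) (1::nat)) (x, j)) =
      (if y = x then if 1 \<le> j \<and> j \<le> Poly_Mapping.lookup m x then 1 else 0 else 0)" for y
    by (auto simp: lookup_single when_def sum.delta)
  then have "Poly_Mapping.lookup (polarize m) (x, j) = (\<Sum>y\<in>Poly_Mapping.keys m.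
      if y = x then if 1 \<le> j \<and> j \<le> Poly_Mapping.lookup m x then 1 else 0 else 0)"
    by (simp only: polarize_def lookup_sum)
  then show ?thesis by (auto simp: in_keys_iff)
qed

lemma keys_polarize:
  "Poly_Mapping.keys (polarize m) = {(x, j). 1 \<le> j \<and> j \<le> Poly_Mapping.lookup m x}"
  by (auto simp: in_keys_iff lookup_polarize split: if_splits)

text \<open>The support of a polarization consists of the points under the graph of the exponent
  vector, so inclusion compares the heights of the columns.\<close>

lemma keys_polarize_subset_iff:
  "Poly_Mapping.keys (polarize m) \<subseteq> Poly_Mapping.keys (polarize m') \<longleftrightarrow> m' \<in> multiples m"
proof
  assume sub: "Poly_Mapping.keys (polarize m) \<subseteq> Poly_Mapping.keys (polarize m')"
  have "Poly_Mapping.lookup m x \<le> Poly_Mapping.lookup m' x" for x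
  proof (cases "Poly_Mapping.lookup m x = 0")
    case False
    then have "(x, Poly_Mapping.lookup m x) \<in> Poly_Mapping.keys (polarize m)"
      by (simp add: keys_polarize)
    then show ?thesis using sub by (auto simp: keys_polarize)
  qed simp
  then show "m' \<in> multiples m" by (simp add: multiples_iff)
qed (auto simp: keys_polarize multiples_iff intro: order_trans)

lemma keys_polarize_inj: "Poly_Mapping.keys (polarize m) = Poly_Mapping.keys (polarize m') \<Longrightarrow> m = m'"
  using keys_polarize_subset_iff[of m m'] keys_polarize_subset_iff[of m' m]
  by (intro poly_mapping_eqI) (simp add: multiples_iff order.antisym)

lemma multiples_squarefree:
  assumes "\<And>v. Poly_Mapping.lookup m v \<le> 1"
  shows "f \<in> multiples m \<longleftrightarrow> Poly_Mapping.keys m \<subseteq> Poly_Mapping.keys f"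
proof -
  have "Poly_Mapping.lookup m v \<le> Poly_Mapping.lookup f v \<longleftrightarrow>
      (v \<in> Poly_Mapping.keys m \<longrightarrow> v \<in> Poly_Mapping.keys f)" for v
    using assms[of v] by (auto simp: in_keys_iff)
  then show ?thesis by (auto simp: multiples_iff)
qed

lemma keys_squarefree_monomial:
  assumes "finite T"
  shows "Poly_Mapping.keys (squarefree_monomial T) = T"
  by (auto simp: in_keys_iff lookup_squarefree_monomial[OF assms] split: if_splits)

text \<open>The supports of any subset of \<open>S\<close> generate a complex, and by
  \<open>anti\<close> they are exactly its facets. A leaf of this complex, with its joint, comes
  from a leaf and a joint among the monomials.\<close>

lemma forest_type_if_leaves:
  fixes \<F> :: "('n \<times> nat) set set"
  assumes fin: "\<And>F. F \<in> \<F> \<Longrightarrow> finite F" "finite \<F>"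
    and anti: "\<And>F G. F \<in> \<F> \<Longrightarrow> G \<in> \<F> \<Longrightarrow> F \<subseteq> G \<Longrightarrow> F = G"
    and leaves: "\<And>\<Gamma>. (\<exists>W. simplicial_complex_on W \<Gamma>) \<Longrightarrow> facets \<Gamma> \<subseteq> \<F> \<Longrightarrow> \<Gamma> \<noteq> {} \<Longrightarrow> \<exists>F. leaf \<Gamma> F"
    and S: "\<And>m. m \<in> S \<Longrightarrow> Poly_Mapping.keys (polarize m) \<in> \<F>"
  shows "forest_type S"
  unfolding forest_type_def
proof (intro allI impI)
  fix T assume T: "T \<subseteq> S" "T \<noteq> {}"
  let ?k = "\<lambda>m. Poly_Mapping.keys (polarize m)"
  let ?F = "?k ` T"
  define \<Gamma> where "\<Gamma> = {G. \<exists>F\<in>?F. G \<subseteq> F}"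
  have F: "?F \<subseteq> \<F>" using T S by auto
  have "finite (\<Union>?F)" using F fin finite_subset[OF F] by (intro finite_Union) auto
  then have "simplicial_complex_on (\<Union>?F) \<Gamma>"
    unfolding simplicial_complex_on_def \<Gamma>_def by blast
  moreover have facets: "facets \<Gamma> = ?F"
  proof
    show "facets \<Gamma> \<subseteq> ?F" unfolding facets_def \<Gamma>_def by blast
    show "?F \<subseteq> facets \<Gamma>"
    proof
      fix A assume A: "A \<in> ?F"
      have "G = A" if G: "G \<in> \<Gamma>" "A \<subseteq> G" for G
      proof -
        obtain B where B: "B \<in> ?F" "G \<subseteq> B" using G(1) by (auto simp: \<Gamma>_def)
        then have "A = B" using anti[of A B] A F G(2) by blast
        then show ?thesis using B G(2) by blast
      qed
      then show "A \<in> facets \<Gamma>" using A by (auto simp: facets_def \<Gamma>_def)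
    qed
  qed
  moreover have "\<Gamma> \<noteq> {}" using T by (auto simp: \<Gamma>_def)
  ultimately obtain L where L: "leaf \<Gamma> L" using leaves[of \<Gamma>] F by blast
  then have "L \<in> ?F" using facets by (simp add: leaf_def)
  then obtain m where m: "m \<in> T" "L = ?k m" by blast
  from L have "?F = {L} \<or> (\<exists>G\<in>?F. G \<noteq> L \<and> (\<forall>H\<in>?F. H \<noteq> L \<longrightarrow> L \<inter> H \<subseteq> G))"
    by (simp add: leaf_def facets)
  then have "T = {m} \<or> (\<exists>g\<in>T. g \<noteq> m \<and> (\<forall>h\<in>T. h \<noteq> m \<longrightarrow>
      (\<forall>x. min (Poly_Mapping.lookup m x) (Poly_Mapping.lookup h x) \<le> Poly_Mapping.lookup g x)))"
  proof
    assume "?F = {L}"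
    then have "h = m" if "h \<in> T" for h using keys_polarize_inj[of h m] that m(2) by blast
    then show ?thesis using m(1) by blast
  next
    assume "\<exists>G\<in>?F. G \<noteq> L \<and> (\<forall>H\<in>?F. H \<noteq> L \<longrightarrow> L \<inter> H \<subseteq> G)"
    then obtain g where g: "g \<in> T" "?k g \<noteq> L" "\<And>h. h \<in> T \<Longrightarrow> ?k h \<noteq> L \<Longrightarrow> L \<inter> ?k h \<subseteq> ?k g"
      by blast
    have joint: "min (Poly_Mapping.lookup m x) (Poly_Mapping.lookup h x) \<le> Poly_Mapping.lookup g x"
      if h: "h \<in> T" "h \<noteq> m" for h x
    proof (cases "min (Poly_Mapping.lookup m x) (Poly_Mapping.lookup h x) = 0")
      case False
      \<comment> \<open>The highest point of the column over \<open>x\<close> common to both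
        supports; its presence in the joint bounds the gcd there.\<close>
      then have "(x, min (Poly_Mapping.lookup m x) (Poly_Mapping.lookup h x)) \<in> L \<inter> ?k h"
        by (simp add: m(2) keys_polarize)
      moreover have "?k h \<noteq> L" using keys_polarize_inj[of h m] h(2) m(2) by blast
      ultimately have "(x, min (Poly_Mapping.lookup m x) (Poly_Mapping.lookup h x)) \<in> ?k g"
        using g(3)[OF h(1)] by blast
      then show ?thesis by (simp add: keys_polarize)
    qed simp
    have "g \<noteq> m" using g(2) m(2) by blast
    then show ?thesis using g(1) joint by (intro disjI2 bexI[of _ g]) simp_all
  qed
  then show "\<exists>m\<in>T. T = {m} \<or> (\<exists>g\<in>T. g \<noteq> m \<and> (\<forall>h\<in>T. h \<noteq> m \<longrightarrow>
      (\<forall>x. min (Poly_Mapping.lookup m x) (Poly_Mapping.lookup h x) \<le> Poly_Mapping.lookup g x)))"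
    using m(1) by blast
qed

theorem corollary4p12:
  fixes I :: "('n::finite, 'k::field) mpoly set"
    and Ms :: "('n \<Rightarrow>\<^sub>0 nat) set"
    and V :: "('n \<times> nat) set"
    and \<Delta> :: "('n \<times> nat) set set"
  assumes "finite Ms"
    and "I = monomial_ideal Ms"
    and "simplicial_tree V \<Delta>"
    and "(monomial_ideal (polarize ` Ms) :: ('n \<times> nat, 'k) mpoly set) = facet_ideal \<Delta>"
  shows "sequentially_cohen_macaulay_ideal mpoly_ring mpoly_homogeneous I"
proof -
  let ?k = "\<lambda>m. Poly_Mapping.keys (polarize m)"
  let ?sq = "squarefree_monomial :: ('n \<times> nat) set \<Rightarrow> _"
  \<comment> \<open>\<open>Ms\<close> may contain redundant generators; those whose polarizations
    are supported on facets will turn out to generate \<open>I\<close>.\<close>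
  define S where "S = {m \<in> Ms. ?k m \<in> facets \<Delta>}"
  have \<Delta>: "simplicial_complex_on V \<Delta>" using assms(3) by (simp add: simplicial_tree_def)
  then have finV: "finite V" and sub: "\<Delta> \<subseteq> Pow V" by (auto simp: simplicial_complex_on_def)
  have fin: "finite F" if "F \<in> facets \<Delta>" for F
    using that sub finite_subset[OF _ finV, of F] by (auto simp: facets_def)
  have finF: "finite (facets \<Delta>)"
    by (rule finite_subset[of _ "Pow V"]) (use sub finV in \<open>auto simp: facets_def\<close>)
  have anti: "F = G" if "F \<in> facets \<Delta>" "G \<in> facets \<Delta>" "F \<subseteq> G" for F G
    using that by (auto simp: facets_def)
  \<comment> \<open>Equality of the ideals is used only on single monomials, which suffices to
    compare supports of generators with facets.\<close>
  have "Poly_Mapping.single f (1::'k) \<in> monomial_ideal (polarize ` Ms) \<longleftrightarrow>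
      Poly_Mapping.single f (1::'k) \<in> monomial_ideal (?sq ` facets \<Delta>)" for f
    using assms(4) by (simp add: facet_ideal_def squarefree_monomial_def)
  then have pol: "(\<exists>m\<in>Ms. f \<in> multiples (polarize m)) \<longleftrightarrow> (\<exists>F\<in>facets \<Delta>. f \<in> multiples (?sq F))" for f
    by (simp add: monomial_ideal_eq)
  have sq: "f \<in> multiples (?sq F) \<longleftrightarrow> F \<subseteq> Poly_Mapping.keys f" "Poly_Mapping.keys (?sq F) = F"
    if "F \<in> facets \<Delta>" for f F
  proof -
    show "Poly_Mapping.keys (?sq F) = F"
      by (rule keys_squarefree_monomial[OF fin[OF that]])
    then show "f \<in> multiples (?sq F) \<longleftrightarrow> F \<subseteq> Poly_Mapping.keys f"
      using fin[OF that] by (subst multiples_squarefree) (auto simp: lookup_squarefree_monomial)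
  qed
  have polm: "f \<in> multiples (polarize m) \<longleftrightarrow> ?k m \<subseteq> Poly_Mapping.keys f" for f and m :: "'n \<Rightarrow>\<^sub>0 nat"
    by (rule multiples_squarefree) (auto simp: lookup_polarize)
  have le: "\<exists>F\<in>facets \<Delta>. F \<subseteq> ?k m" if "m \<in> Ms" for m
  proof -
    have "\<exists>m'\<in>Ms. polarize m \<in> multiples (polarize m')" using that polm by blast
    then obtain F where "F \<in> facets \<Delta>" "polarize m \<in> multiples (?sq F)" using pol by blast
    then show ?thesis using sq(1) by blast
  qed
  \<comment> \<open>\<open>F\<close> contains the support of some generator, which in turn contains
    a facet; facets are incomparable, so all three agree.\<close>
  have ex: "\<exists>m\<in>S. ?k m = F" if F: "F \<in> facets \<Delta>" for F
  proof -
    obtain m where m: "m \<in> Ms" "?k m \<subseteq> F"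
      using pol[of "?sq F"] F sq polm by auto
    obtain F' where "F' \<in> facets \<Delta>" "F' \<subseteq> ?k m" using le[OF m(1)] by blast
    moreover from this have "F' = F" using anti[of F' F] F m(2) by blast
    ultimately show ?thesis using m F by (auto simp: S_def)
  qed
  \<comment> \<open>Each support contains a facet, and inclusion of supports means divisibility
    before polarization.\<close>
  have "(\<Union>m\<in>Ms. multiples m) = (\<Union>m\<in>S. multiples m)"
  proof
    have "\<exists>m'\<in>S. m \<in> multiples m'" if "m \<in> Ms" for m
      using le[OF that] ex keys_polarize_subset_iff by metis
    then show "(\<Union>m\<in>Ms. multiples m) \<subseteq> (\<Union>m\<in>S. multiples m)"
      by (fastforce simp: multiples_iff intro: order_trans)
  qed (auto simp: S_def)
  then have "I = monomial_span (\<Union>m\<in>S. multiples m)"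
    by (simp add: assms(2) monomial_ideal_eq)
  moreover have "forest_type S"
  proof (rule forest_type_if_leaves[OF fin finF anti])
    show "\<exists>F. leaf \<Gamma> F" if "\<exists>W. simplicial_complex_on W \<Gamma>" "facets \<Gamma> \<subseteq> facets \<Delta>" "\<Gamma> \<noteq> {}" for \<Gamma>
      using assms(3) that by (simp add: simplicial_tree_def subcollection_def)
  qed (auto simp: S_def)
  moreover have "finite S" using assms(1) by (simp add: S_def)
  ultimately show ?thesis using sequentially_cohen_macaulay_forest_type by blast
qed

end
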